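(* Let $T \in \mathcal{AN}(H)$ be quasinormal. Then there exist reducing subspaces $H_1, H_\infty, H_2$ of $T$ with $\dim(H_2) < \infty$ such that $H = H_1 \oplus H_\infty \oplus H_2$ and, with respect to this decomposition, $T$ can be written as $$T = \bigoplus_{i=1}^{n} \alpha_i U_i \ \oplus\ \alpha V_\infty \ \oplus\ \bigoplus_{j=1}^{m} \beta_j V_j$$ for some $n \in \mathbb{N} \cup \{\infty\}$ and $m \in \mathbb{N}$, where (i) $\sigma_{ess}(|T|) = \{\alpha\}$, $\alpha \geq 0$, $H_\infty = N(|T| - \alpha I)$ and $V_\infty \in \mathcal{B}(H_\infty)$ is an isometry; (ii) $\{\alpha_i\}_{i=1}^{n} = (\alpha, \|T\|] \cap \sigma(|T|)$, $H_1 = \bigoplus_{i=1}^{n} N(|T| - \alpha_i I)$ and $U_i \in \mathcal{B}(N(|T| - \alpha_i I))$ is a unitary operator for every $i$; (iii) $\{\beta_j\}_{j=1}^{m} = [m(T), \alpha) \cap \sigma(|T|)$, $H_2 = \bigoplus_{j=1}^{m} N(|T| - \beta_j I)$ and $V_j \in \mathcal{B}(N(|T| - \beta_j I))$ is a unitary operator for every $j$.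
   Context: $H$ is an infinite-dimensional complex Hilbert space and $\mathcal{B}(H)$ the bounded linear operators on $H$. $N(\cdot)$ denotes the null space, $\sigma(\cdot)$ the spectrum, $|T| = (T^*T)^{1/2}$, and $m(T) = \inf\{\|Tx\| : \|x\| = 1\}$. $T \in \mathcal{B}(H)$ is norm attaining if $\|Tx\| = \|T\|$ for some unit vector $x$; $T \in \mathcal{AN}(H)$ (absolutely norm attaining) means $T|_M : M \to H$ is norm attaining for every nonzero closed subspace $M$ of $H$. $T$ is quasinormal if $T$ commutes with $T^*T$. $T$ is Fredholm if $R(T)$ is closed and $N(T)$, $N(T^* )$ are finite dimensional; $\sigma_{ess}(T) = \{\lambda \in \mathbb{C} : T - \lambda I \text{ is not Fredholm}\}$. The $\alpha_i$ are distinct, the $\beta_j$ are distinct. Either of the families $\{\alpha_i\}$, $\{\beta_j\}$ may be empty (i.e. $n=0$ or $m=0$), in which case the corresponding summand is absent and the corresponding subspace is $\{0\}$; $H_\infty$ may also be $\{0\}$. *)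

theory Defs
  imports "HOL-Analysis.Analysis"
begin

section \<open>Complex Hilbert spaces\<close>

class complex_vector = real_vector +
  fixes scaleC :: "complex \<Rightarrow> 'a \<Rightarrow> 'a"  (infixr \<open>*\<^sub>C\<close> 75)
  assumes scaleC_add_right: "a *\<^sub>C (x + y) = a *\<^sub>C x + a *\<^sub>C y"
    and scaleC_add_left: "(a + b) *\<^sub>C x = a *\<^sub>C x + b *\<^sub>C x"
    and scaleC_scaleC: "a *\<^sub>C b *\<^sub>C x = (a * b) *\<^sub>C x"
    and scaleC_one: "1 *\<^sub>C x = x"
    and scaleR_scaleC: "scaleR r x = complex_of_real r *\<^sub>C x"

global_interpretation complex_vector: vector_space
    "scaleC :: complex \<Rightarrow> 'a \<Rightarrow> 'a::complex_vector"
  defines csubspace = complex_vector.subspace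
    and cspan = complex_vector.span
  by unfold_locales
    (simp_all add: scaleC_add_right scaleC_add_left scaleC_scaleC scaleC_one)

text \<open>The complex inner product is linear in the first argument and its real part is the
  inner product of the underlying real Hilbert space. Hence the norm inherited from
  \<^class>\<open>real_inner\<close> satisfies \<open>\<parallel>x\<parallel>\<^sup>2 = \<langle>x, x\<rangle>\<close>, and positive definiteness is inherited as well.\<close>

class chilbert_space = complex_vector + real_inner + complete_space +
  fixes cinner :: "'a \<Rightarrow> 'a \<Rightarrow> complex"
  assumes cinner_commute: "cinner x y = cnj (cinner y x)"
    and cinner_add_left: "cinner (x + y) z = cinner x z + cinner y z"
    and cinner_scaleC_left: "cinner (a *\<^sub>C x) y = a * cinner x y"
    and Re_cinner: "Re (cinner x y) = inner x y"

instance chilbert_space \<subseteq> banach ..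

lemma cinner_self: "cinner x x = complex_of_real ((norm (x :: 'a::chilbert_space))\<^sup>2)"
proof -
  have "Im (cinner x x) = 0"
    using arg_cong[OF cinner_commute[of x x], of Im] by simp
  then show ?thesis
    by (simp add: complex_eq_iff Re_cinner power2_norm_eq_inner)
qed

text \<open>Dimension is always complex dimension.\<close>

definition cfinite_dim :: "'a::complex_vector set \<Rightarrow> bool" where
  "cfinite_dim M \<longleftrightarrow> (\<exists>B. finite B \<and> M \<subseteq> cspan B)"

definition closed_csubspace :: "'a::chilbert_space set \<Rightarrow> bool" where
  "closed_csubspace M \<longleftrightarrow> csubspace M \<and> closed M"

definition corthogonal :: "'a::chilbert_space set \<Rightarrow> 'a set \<Rightarrow> bool" where
  "corthogonal M N \<longleftrightarrow> (\<forall>x\<in>M. \<forall>y\<in>N. cinner x y = 0)"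

definition ccomplement :: "'a::chilbert_space set \<Rightarrow> 'a set" where
  "ccomplement M = {y. \<forall>x\<in>M. cinner y x = 0}"


section \<open>Bounded operators\<close>

definition bounded_clinear :: "('a::chilbert_space \<Rightarrow> 'a) \<Rightarrow> bool" where
  "bounded_clinear T \<longleftrightarrow> bounded_linear T \<and> (\<forall>c x. T (c *\<^sub>C x) = c *\<^sub>C T x)"

text \<open>Operators on a subspace \<open>M\<close> are total functions of which only the values on \<open>M\<close> matter;
  the following says that the restriction of \<open>A\<close> to \<open>M\<close> is an element of \<open>\<B>(M)\<close>.\<close>

definition bounded_clinear_on :: "'a::chilbert_space set \<Rightarrow> ('a \<Rightarrow> 'a) \<Rightarrow> bool" where
  "bounded_clinear_on M A \<longleftrightarrow>
     (\<forall>x\<in>M. A x \<in> M) \<and>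
     (\<forall>x\<in>M. \<forall>y\<in>M. A (x + y) = A x + A y) \<and>
     (\<forall>c. \<forall>x\<in>M. A (c *\<^sub>C x) = c *\<^sub>C A x) \<and>
     (\<exists>K. \<forall>x\<in>M. norm (A x) \<le> norm x * K)"

lemma bounded_clinear_on_UNIV: "bounded_clinear_on UNIV A \<longleftrightarrow> bounded_clinear A"
proof
  assume A: "bounded_clinear_on UNIV A"
  then obtain K where K: "\<And>x. norm (A x) \<le> norm x * K"
    by (auto simp: bounded_clinear_on_def)
  have "bounded_linear A"
  proof (rule bounded_linear_intro)
    show "norm (A x) \<le> norm x * K" for x by (rule K)
  qed (use A in \<open>auto simp: bounded_clinear_on_def scaleR_scaleC\<close>)
  then show "bounded_clinear A"
    using A by (auto simp: bounded_clinear_def bounded_clinear_on_def)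
next
  assume A: "bounded_clinear A"
  then interpret bounded_linear A by (simp add: bounded_clinear_def)
  show "bounded_clinear_on UNIV A"
    using A bounded by (auto simp: bounded_clinear_def bounded_clinear_on_def add)
qed

definition is_cadjoint_on :: "'a::chilbert_space set \<Rightarrow> ('a \<Rightarrow> 'a) \<Rightarrow> ('a \<Rightarrow> 'a) \<Rightarrow> bool" where
  "is_cadjoint_on M A B \<longleftrightarrow>
     bounded_clinear_on M B \<and> (\<forall>x\<in>M. \<forall>y\<in>M. cinner (A x) y = cinner x (B y))"

definition cadjoint :: "('a::chilbert_space \<Rightarrow> 'a) \<Rightarrow> 'a \<Rightarrow> 'a" where
  "cadjoint T = (THE S. is_cadjoint_on UNIV T S)"

definition positive_op :: "('a::chilbert_space \<Rightarrow> 'a) \<Rightarrow> bool" where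
  "positive_op A \<longleftrightarrow>
     bounded_clinear A \<and> (\<forall>x. cinner (A x) x \<in> \<real> \<and> 0 \<le> Re (cinner (A x) x))"

definition op_sqrt :: "('a::chilbert_space \<Rightarrow> 'a) \<Rightarrow> 'a \<Rightarrow> 'a" where
  "op_sqrt A = (THE P. positive_op P \<and> P \<circ> P = A)"

definition abs_op :: "('a::chilbert_space \<Rightarrow> 'a) \<Rightarrow> 'a \<Rightarrow> 'a" where
  "abs_op T = op_sqrt (cadjoint T \<circ> T)"

definition null_space :: "('a::chilbert_space \<Rightarrow> 'a) \<Rightarrow> 'a set" where
  "null_space A = {x. A x = 0}"

definition op_shift :: "('a::chilbert_space \<Rightarrow> 'a) \<Rightarrow> complex \<Rightarrow> 'a \<Rightarrow> 'a" where
  "op_shift A c = (\<lambda>x. A x - c *\<^sub>C x)"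

definition invertible_op :: "('a::chilbert_space \<Rightarrow> 'a) \<Rightarrow> bool" where
  "invertible_op A \<longleftrightarrow> (\<exists>B. bounded_clinear B \<and> B \<circ> A = id \<and> A \<circ> B = id)"

definition op_spectrum :: "('a::chilbert_space \<Rightarrow> 'a) \<Rightarrow> complex set" where
  "op_spectrum A = {c. \<not> invertible_op (op_shift A c)}"

definition fredholm :: "('a::chilbert_space \<Rightarrow> 'a) \<Rightarrow> bool" where
  "fredholm A \<longleftrightarrow>
     closed (range A) \<and> cfinite_dim (null_space A) \<and> cfinite_dim (null_space (cadjoint A))"

definition ess_spectrum :: "('a::chilbert_space \<Rightarrow> 'a) \<Rightarrow> complex set" where
  "ess_spectrum A = {c. \<not> fredholm (op_shift A c)}"

definition min_modulus :: "('a::chilbert_space \<Rightarrow> 'a) \<Rightarrow> real" where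
  "min_modulus T = (INF x\<in>{x. norm x = 1}. norm (T x))"

text \<open>The norm of the restriction to \<open>M\<close>, written like \<^const>\<open>onorm\<close>, which is the case
  \<open>M = UNIV\<close>.\<close>

definition onorm_on :: "'a::chilbert_space set \<Rightarrow> ('a \<Rightarrow> 'a) \<Rightarrow> real" where
  "onorm_on M T = (SUP x\<in>M. norm (T x) / norm x)"

definition norm_attaining_on :: "'a::chilbert_space set \<Rightarrow> ('a \<Rightarrow> 'a) \<Rightarrow> bool" where
  "norm_attaining_on M T \<longleftrightarrow> (\<exists>x\<in>M. norm x = 1 \<and> norm (T x) = onorm_on M T)"

definition absolutely_norm_attaining :: "('a::chilbert_space \<Rightarrow> 'a) \<Rightarrow> bool" where
  "absolutely_norm_attaining T \<longleftrightarrow>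
     bounded_clinear T \<and>
     (\<forall>M. closed_csubspace M \<and> M \<noteq> {0} \<longrightarrow> norm_attaining_on M T)"

definition quasinormal :: "('a::chilbert_space \<Rightarrow> 'a) \<Rightarrow> bool" where
  "quasinormal T \<longleftrightarrow>
     bounded_clinear T \<and> T \<circ> (cadjoint T \<circ> T) = (cadjoint T \<circ> T) \<circ> T"

definition reducing :: "('a::chilbert_space \<Rightarrow> 'a) \<Rightarrow> 'a set \<Rightarrow> bool" where
  "reducing T M \<longleftrightarrow>
     closed_csubspace M \<and> T ` M \<subseteq> M \<and> T ` ccomplement M \<subseteq> ccomplement M"

definition isometry_on :: "'a::chilbert_space set \<Rightarrow> ('a \<Rightarrow> 'a) \<Rightarrow> bool" where
  "isometry_on M V \<longleftrightarrow> bounded_clinear_on M V \<and> (\<forall>x\<in>M. norm (V x) = norm x)"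

definition unitary_on :: "'a::chilbert_space set \<Rightarrow> ('a \<Rightarrow> 'a) \<Rightarrow> bool" where
  "unitary_on M U \<longleftrightarrow>
     bounded_clinear_on M U \<and>
     (\<exists>W. is_cadjoint_on M U W \<and> (\<forall>x\<in>M. W (U x) = x \<and> U (W x) = x))"


section \<open>Orthogonal direct sums\<close>

text \<open>\<open>S\<close> is the internal Hilbert space direct sum of the pairwise orthogonal closed subspaces
  \<open>M i\<close>, \<open>i \<in> I\<close>, of the ambient space. The empty sum is \<open>{0}\<close>. For an orthogonal family,
  \<open>has_sum\<close> convergence amounts to summability of the squared norms.\<close>

definition is_hilbert_sum ::
  "'i set \<Rightarrow> ('i \<Rightarrow> 'a::chilbert_space set) \<Rightarrow> 'a set \<Rightarrow> bool" where
  "is_hilbert_sum I M S \<longleftrightarrow>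
     (\<forall>i\<in>I. closed_csubspace (M i)) \<and>
     (\<forall>i\<in>I. \<forall>j\<in>I. i \<noteq> j \<longrightarrow> corthogonal (M i) (M j)) \<and>
     S = {x. \<exists>f. (\<forall>i\<in>I. f i \<in> M i) \<and> (f has_sum x) I}"

text \<open>On the direct sum of the \<open>M i\<close>, the operator \<open>B\<close> is the direct sum of the operators \<open>A i\<close>
  on \<open>M i\<close>.\<close>

definition is_op_hilbert_sum ::
  "'i set \<Rightarrow> ('i \<Rightarrow> 'a::chilbert_space set) \<Rightarrow> ('i \<Rightarrow> 'a \<Rightarrow> 'a) \<Rightarrow> ('a \<Rightarrow> 'a) \<Rightarrow> bool" where
  "is_op_hilbert_sum I M A B \<longleftrightarrow>
     (\<forall>f x. (\<forall>i\<in>I. f i \<in> M i) \<and> (f has_sum x) I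
        \<longrightarrow> ((\<lambda>i. A i (f i)) has_sum B x) I)"

definition is_orthogonal_sum3 ::
  "'a::chilbert_space set \<Rightarrow> 'a set \<Rightarrow> 'a set \<Rightarrow> 'a set \<Rightarrow> bool" where
  "is_orthogonal_sum3 M N K S \<longleftrightarrow>
     closed_csubspace M \<and> closed_csubspace N \<and> closed_csubspace K \<and>
     corthogonal M N \<and> corthogonal M K \<and> corthogonal N K \<and>
     S = {x + y + z | x y z. x \<in> M \<and> y \<in> N \<and> z \<in> K}"

end

theory Submission
  imports Defs
begin

text \<open>The maximum of \<open>\<parallel>T x\<parallel>\<close> over the unit sphere of a subspace invariant under \<open>T\<^sup>* T\<close> is attained
  at an eigenvector of \<open>T\<^sup>* T\<close>. Hence \<open>H\<close> is the Hilbert sum of the eigenspaces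
  \<open>E\<^sub>r = {x. T\<^sup>* T x = r\<^sup>2 x}\<close>, \<open>r \<ge> 0\<close>, and \<open>|T|\<close> is the diagonal operator with value \<open>r\<close> on \<open>E\<^sub>r\<close>.

  There is no orthonormal sequence \<open>g\<^sub>n\<close> with \<open>T g\<^sub>n\<close> pairwise orthogonal and \<open>\<parallel>T g\<^sub>n\<parallel>\<close> strictly
  increasing, since \<open>T\<close> would not attain its norm on the closed span. Mixing eigenvectors, this shows
  that for \<open>s < t\<close> one of the sums of the \<open>E\<^sub>r\<close> with \<open>r < s\<close> and with \<open>r \<ge> t\<close> is finite dimensional. So
  the eigenvalues, with multiplicity, can only accumulate at one point \<open>\<alpha>\<close>, and by the same principle
  only finitely many lie below \<open>\<alpha>\<close>. The spectral statements about \<open>|T|\<close> are then read off from its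
  diagonal form. Quasinormality makes every \<open>E\<^sub>r\<close> reducing for \<open>T\<close>, which acts there as \<open>r\<close> times an
  isometry; if \<open>r \<noteq> \<alpha>\<close>, this isometry is unitary because \<open>E\<^sub>r\<close> is finite dimensional.\<close>

section \<open>Complex inner products and the Riesz representation\<close>

text \<open>Eigenvectors alone need not provide an increasing sequence: there may be a single
  eigenvalue below \<open>s\<close> and a single one above \<open>t\<close>, both of infinite
  multiplicity. Unit combinations of one vector from each side realise all intermediate values of
  \<open>norm (T v)\<close>, which is why vectors are mixed. The point \<alpha> arises as the
  supremum of the thresholds below which the spectral subspace is finite dimensional; the infinite
  dimension of the space keeps this supremum finite. That the shift at \<alpha> is not Fredholm has
  two possible causes: an infinite-dimensional eigenspace, or eigenvalues accumulating at \<alpha>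
  from above, in which case the range is not closed. The modulus enters late. Eigenspaces and
  spectral subspaces are built from the adjoint and \<open>T\<close>; afterwards the positive square
  root is found, and shown unique, through its action on the eigenspaces.\<close>

lemma cinner_add_right: "cinner (x :: 'a::chilbert_space) (y + z) = cinner x y + cinner x z"
  by (metis cinner_add_left cinner_commute complex_cnj_add)

lemma cinner_scaleC_right: "cinner (x :: 'a::chilbert_space) (c *\<^sub>C y) = cnj c * cinner x y"
  by (metis cinner_commute cinner_scaleC_left complex_cnj_mult)

lemma cinner_scaleR_left: "cinner (r *\<^sub>R x :: 'a::chilbert_space) y = of_real r * cinner x y"
  by (simp add: scaleR_scaleC cinner_scaleC_left)

lemma cinner_scaleR_right: "cinner (x :: 'a::chilbert_space) (r *\<^sub>R y) = of_real r * cinner x y"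
  by (simp add: scaleR_scaleC cinner_scaleC_right)

lemma cinner_zero [simp]: "cinner (0 :: 'a::chilbert_space) y = 0" "cinner y (0 :: 'a) = 0"
  using cinner_add_left[of 0 0 y] cinner_add_right[of y 0 0] by simp_all

lemma cinner_diff_left: "cinner (x - y :: 'a::chilbert_space) z = cinner x z - cinner y z"
  using cinner_add_left[of "x - y" y z] by simp

lemma cinner_diff_right: "cinner (x :: 'a::chilbert_space) (y - z) = cinner x y - cinner x z"
  using cinner_add_right[of x "y - z" z] by simp

lemma Im_cinner: "Im (cinner x y) = inner x (\<i> *\<^sub>C y :: 'a::chilbert_space)"
  by (simp flip: Re_cinner add: cinner_scaleC_right)

lemma cinner_eq_zero_sym: "cinner x y = 0 \<longleftrightarrow> cinner y (x :: 'a::chilbert_space) = 0"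
  by (metis cinner_commute complex_cnj_zero)

lemma cinner_self_eq_zero [simp]: "cinner x x = 0 \<longleftrightarrow> (x :: 'a::chilbert_space) = 0"
  by (simp add: cinner_self)

lemma norm_scaleC [simp]: "norm (c *\<^sub>C x :: 'a::chilbert_space) = cmod c * norm x"
proof -
  have "complex_of_real ((norm (c *\<^sub>C x))\<^sup>2) = complex_of_real ((cmod c * norm x)\<^sup>2)"
    unfolding cinner_self[symmetric]
    by (simp add: cinner_scaleC_left cinner_scaleC_right)
       (simp add: cinner_self power_mult_distrib, metis complex_norm_square mult.commute of_real_power)
  then have "(norm (c *\<^sub>C x))\<^sup>2 = (cmod c * norm x)\<^sup>2"
    by (simp only: of_real_eq_iff)
  then show ?thesis
    by (simp add: power2_eq_iff_nonneg)
qed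

lemma norm_cinner_le: "cmod (cinner x y) \<le> norm x * norm (y :: 'a::chilbert_space)"
proof (cases "cinner x y = 0")
  case False
  \<comment> \<open>The unimodular factor \<open>c\<close> rotates the inner product onto its
    modulus, so the real Cauchy-Schwarz inequality applies.\<close>
  define c where "c = cnj (sgn (cinner x y))"
  have c: "cmod c = 1" using False by (simp add: c_def norm_sgn)
  have "cinner (c *\<^sub>C x) y = of_real (cmod (cinner x y))"
    using False unfolding cinner_scaleC_left c_def
    by (simp add: sgn_div_norm complex_norm_square[symmetric] scaleR_conv_of_real
        power2_eq_square field_simps flip: complex_norm_square)
  then have "cmod (cinner x y) = inner (c *\<^sub>C x) y"
    by (simp flip: Re_cinner)
  also have "\<dots> \<le> norm (c *\<^sub>C x) * norm y" by (rule norm_cauchy_schwarz)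
  finally show ?thesis using c by simp
qed simp

lemma bounded_linear_cinner_left: "bounded_linear (\<lambda>x. cinner x (y :: 'a::chilbert_space))"
  by (rule bounded_linear_intro[where K = "norm y"])
     (auto simp: cinner_add_left cinner_scaleR_left scaleR_conv_of_real norm_cinner_le)

lemma bounded_linear_cinner_right: "bounded_linear (cinner (y :: 'a::chilbert_space))"
  by (rule bounded_linear_intro[where K = "norm y"])
     (auto simp: cinner_add_right cinner_scaleR_right scaleR_conv_of_real
       norm_cinner_le mult.commute[of "norm _" "norm y"])

lemma bounded_linear_scaleC: "bounded_linear (\<lambda>x :: 'a::chilbert_space. c *\<^sub>C x)"
  by (rule bounded_linear_intro[where K = "cmod c"])
     (auto simp: scaleC_add_right scaleR_scaleC scaleC_scaleC mult_ac)

section \<open>Series of orthogonal vectors\<close>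

lemma has_sum_cinner_left:
  "(f has_sum x) I \<Longrightarrow> ((\<lambda>i. cinner (f i) y) has_sum cinner x (y :: 'a::chilbert_space)) I"
  using has_sum_bounded_linear[OF bounded_linear_cinner_left] by blast

lemma norm_add_sq_orthogonal:
  "cinner x y = 0 \<Longrightarrow> (norm (x + y :: 'a::chilbert_space))\<^sup>2 = (norm x)\<^sup>2 + (norm y)\<^sup>2"
  using cinner_eq_zero_sym[of x y]
  by (simp add: power2_norm_eq_inner Re_cinner[symmetric] cinner_add_left cinner_add_right)

lemma norm_sum_sq_orthogonal:
  fixes f :: "'i \<Rightarrow> 'a::chilbert_space"
  assumes "finite F" "\<And>i j. i \<in> F \<Longrightarrow> j \<in> F \<Longrightarrow> i \<noteq> j \<Longrightarrow> cinner (f i) (f j) = 0"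
  shows "(norm (\<Sum>i\<in>F. f i))\<^sup>2 = (\<Sum>i\<in>F. (norm (f i))\<^sup>2)"
  using assms
proof (induction F rule: finite_induct)
  case (insert i F)
  have "cinner (f i) (\<Sum>i\<in>F. f i) = (\<Sum>j\<in>F. cinner (f i) (f j))"
    by (rule bounded_linear.linear[OF bounded_linear_cinner_right, THEN linear_sum])
  also have "\<dots> = 0" using insert by (intro sum.neutral) auto
  finally show ?case using insert by (simp add: norm_add_sq_orthogonal)
qed simp

lemma has_sum_norm_sq_orthogonal:
  fixes f :: "'i \<Rightarrow> 'a::chilbert_space"
  assumes "(f has_sum x) I" "\<And>i j. i \<in> I \<Longrightarrow> j \<in> I \<Longrightarrow> i \<noteq> j \<Longrightarrow> cinner (f i) (f j) = 0"
  shows "((\<lambda>i. (norm (f i))\<^sup>2) has_sum (norm x)\<^sup>2) I"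
proof -
  have "((\<lambda>F. (norm (sum f F))\<^sup>2) \<longlongrightarrow> (norm x)\<^sup>2) (finite_subsets_at_top I)"
    using assms(1) unfolding has_sum_def by (intro tendsto_intros)
  moreover have "\<forall>\<^sub>F F in finite_subsets_at_top I.
      (norm (sum f F))\<^sup>2 = (\<Sum>i\<in>F. (norm (f i))\<^sup>2)"
    using assms(2) by (intro eventually_finite_subsets_at_top_weakI norm_sum_sq_orthogonal) auto
  ultimately show ?thesis
    unfolding has_sum_def by (rule Lim_transform_eventually)
qed

text \<open>Pythagoras turns the distance between nested partial sums into a difference of partial
  sums of squared norms, so the net of partial sums is Cauchy.\<close>

lemma summable_on_orthogonal:
  fixes f :: "'i \<Rightarrow> 'a::chilbert_space"
  assumes "(\<lambda>i. (norm (f i))\<^sup>2) summable_on I"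
    and orth: "\<And>i j. i \<in> I \<Longrightarrow> j \<in> I \<Longrightarrow> i \<noteq> j \<Longrightarrow> cinner (f i) (f j) = 0"
  shows "f summable_on I"
proof -
  let ?F = "finite_subsets_at_top I" and ?q = "\<lambda>i. (norm (f i))\<^sup>2"
  obtain L where L: "(?q has_sum L) I" using assms(1) by (auto simp: summable_on_def)
  have q_le: "sum ?q G \<le> L" if "finite G" "G \<subseteq> I" for G
    using has_sum_mono2[OF has_sum_finite[OF that(1)] L that(2)] by simp
  have "cauchy_filter (filtermap (sum f) ?F)"
    unfolding cauchy_filter_metric_filtermap
  proof (intro allI impI)
    fix e :: real assume e: "0 < e"
    have "\<forall>\<^sub>F F in ?F. dist (sum ?q F) L < e\<^sup>2 / 4"
      using L e unfolding has_sum_def by (intro tendstoD) auto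
    then obtain X where X: "finite X" "X \<subseteq> I" "dist (sum ?q X) L < e\<^sup>2 / 4"
      unfolding eventually_finite_subsets_at_top by (metis order_refl)
    \<comment> \<open>Enlarging \<open>X\<close> adds at most the remaining mass
      \<open>L - sum ?q X\<close>, which is below \<open>(e / 2)\<^sup>2\<close>; two enlargements
      are thus within \<open>e\<close> of each other.\<close>
    have near: "dist (sum f Y) (sum f X) < e / 2" if Y: "finite Y" "X \<subseteq> Y" "Y \<subseteq> I" for Y
    proof -
      have "(dist (sum f Y) (sum f X))\<^sup>2 = (norm (sum f (Y - X)))\<^sup>2"
        using Y X by (simp add: dist_norm sum_diff)
      also have "\<dots> = sum ?q (Y - X)"
        using Y by (intro norm_sum_sq_orthogonal orth) auto
      also have "\<dots> = sum ?q Y - sum ?q X" using Y X by (simp add: sum_diff)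
      also have "\<dots> \<le> L - sum ?q X" using q_le[of Y] Y by simp
      also have "\<dots> < (e / 2)\<^sup>2" using X(3) abs_ge_minus_self[of "sum ?q X - L"]
        by (simp add: dist_real_def power_divide del: abs_ge_minus_self)
      finally show ?thesis by (rule power_less_imp_less_base) (use e in simp)
    qed
    let ?P = "\<lambda>Y. finite Y \<and> X \<subseteq> Y \<and> Y \<subseteq> I"
    have "eventually ?P ?F" using X by (auto simp: eventually_finite_subsets_at_top)
    moreover have "dist (sum f Y) (sum f Z) < e" if "?P Y \<and> ?P Z" for Y Z
      using near[of Y] near[of Z] that dist_triangle_half_r by (metis dist_commute)
    ultimately show "\<exists>P. eventually P ?F \<and> (\<forall>Y Z. P Y \<and> P Z \<longrightarrow> dist (sum f Y) (sum f Z) < e)"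
      by blast
  qed
  moreover have "complete (UNIV :: 'a set)"
    by (meson Cauchy_convergent UNIV_I complete_def convergent_def)
  ultimately obtain x where "(sum f \<longlongrightarrow> x) ?F"
    using complete_uniform[where S = UNIV] by (force simp: filterlim_def)
  then show ?thesis by (auto simp: summable_on_def has_sum_def)
qed

section \<open>Complements, projections and adjoints\<close>

lemma csubspace_ccomplement: "csubspace (ccomplement (M :: 'a::chilbert_space set))"
  by (auto simp: complex_vector.subspace_def ccomplement_def cinner_add_left cinner_scaleC_left)

lemma closed_ccomplement: "closed (ccomplement (M :: 'a::chilbert_space set))"
proof -
  have "ccomplement M = (\<Inter>x\<in>M. {y. cinner y x = 0})"
    by (auto simp: ccomplement_def)
  moreover have "closed {y. cinner y x = 0}" for x :: 'a
    by (intro closed_Collect_eq continuous_intros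
        bounded_linear.continuous_on[OF bounded_linear_cinner_left])
  ultimately show ?thesis by auto
qed

lemma closed_csubspace_ccomplement: "closed_csubspace (ccomplement (M :: 'a::chilbert_space set))"
  by (simp add: closed_csubspace_def csubspace_ccomplement closed_ccomplement)

text \<open>The first-order condition at a minimum: for small \<open>t\<close> the linear term
  outweighs the quadratic one.\<close>

lemma quadratic_nonneg_imp_zero:
  fixes b q :: real
  assumes "\<And>t. 0 \<le> 2 * t * b + t\<^sup>2 * q"
  shows "b = 0"
proof -
  define t where "t = - b / (\<bar>q\<bar> + 1)"
  have tq: "t * (\<bar>q\<bar> + 1) = - b" by (simp add: t_def)
  then have "t * (t * (\<bar>q\<bar> + 1)) = t * - b" by simp
  then have "t\<^sup>2 * \<bar>q\<bar> = - (t * b) - t\<^sup>2" by (simp add: power2_eq_square algebra_simps)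
  moreover have "t\<^sup>2 * q \<le> t\<^sup>2 * \<bar>q\<bar>" by (intro mult_left_mono) auto
  moreover have "0 \<le> 2 * (t * b) + t\<^sup>2 * q" using assms[of t] by (simp add: mult.assoc)
  ultimately have "t\<^sup>2 \<le> t * b" by linarith
  moreover have "t * b \<le> 0" by (simp add: t_def divide_nonneg_pos)
  ultimately have "t\<^sup>2 \<le> 0" by linarith
  then show ?thesis using tq by simp
qed

text \<open>Minimising \<open>\<parallel>y\<parallel>\<^sup>2 - 2 f y\<close> over \<open>M\<close> yields both the Riesz representation theorem
  (\<open>M = UNIV\<close>) and orthogonal projections (\<open>f = inner x\<close>).\<close>

lemma riesz_on_closed_subspace:
  fixes M :: "'a::{real_inner, complete_space} set"
  assumes sub: "subspace M" and cl: "closed M" and f: "bounded_linear f"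
  obtains y where "y \<in> M" "\<And>z. z \<in> M \<Longrightarrow> inner y z = f z"
proof -
  interpret f: bounded_linear f by fact
  obtain K where K: "\<And>x. norm (f x) \<le> norm x * K" using f.bounded by blast
  define J where "J y = (norm y)\<^sup>2 - 2 * f y" for y
  have J_ge: "J y \<ge> - K\<^sup>2" for y
  proof -
    have "0 \<le> (norm y - K)\<^sup>2" by simp
    moreover have "f y \<le> norm y * K" using K[of y] by simp
    ultimately show ?thesis unfolding J_def by (simp add: power2_eq_square algebra_simps)
  qed
  define d where "d = Inf (J ` M)"
  have bdd: "bdd_below (J ` M)" using J_ge by (intro bdd_belowI2)
  have d_le: "d \<le> J y" if "y \<in> M" for y
    unfolding d_def by (rule cINF_lower[OF bdd that])
  have "\<exists>y\<in>M. J y < d + 1 / Suc n" for n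
  proof (rule ccontr)
    assume "\<not> ?thesis"
    then have "d + 1 / Suc n \<le> d"
      unfolding d_def using subspace_0[OF sub]
      by (intro cINF_greatest) (auto simp: not_less d_def)
    then show False by simp
  qed
  then obtain y where y: "\<And>n. y n \<in> M" "\<And>n. J (y n) < d + 1 / Suc n" by metis
  \<comment> \<open>The midpoint of \<open>u\<close> and \<open>v\<close> stays in \<open>M\<close>,
    so its value is at least \<open>d\<close>; by the parallelogram law almost minimal points are
    then close together.\<close>
  have para: "(norm (u - v))\<^sup>2 \<le> 2 * (J u - d) + 2 * (J v - d)" if "u \<in> M" "v \<in> M" for u v
  proof -
    have "(1/2) *\<^sub>R (u + v) \<in> M" using that sub by (simp add: subspace_add subspace_scale)
    from d_le[OF this] have "d \<le> (1/4) * (norm (u + v))\<^sup>2 - f (u + v)"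
      by (simp add: J_def f.scaleR power_divide del: scaleR_add_right)
    then have "4 * d \<le> (norm (u + v))\<^sup>2 - 4 * f u - 4 * f v"
      by (simp add: f.add)
    moreover have "(norm (u - v))\<^sup>2 + (norm (u + v))\<^sup>2 = 2 * (norm u)\<^sup>2 + 2 * (norm v)\<^sup>2"
      by (simp add: power2_norm_eq_inner inner_add inner_diff inner_commute)
    ultimately show ?thesis by (simp add: J_def)
  qed
  have "Cauchy y"
  proof (rule metric_CauchyI)
    fix e :: real assume "0 < e"
    then obtain N where N: "inverse (real (Suc N)) < e\<^sup>2 / 4"
      using reals_Archimedean[of "e\<^sup>2/4"] by auto
    have "dist (y m) (y n) < e" if "m \<ge> N" "n \<ge> N" for m n
    proof -
      have "J (y k) - d < e\<^sup>2 / 4" if "k \<ge> N" for k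
      proof -
        have "1 / Suc k \<le> 1 / Suc N" using that by (simp add: frac_le)
        then show ?thesis using y(2)[of k] N by (simp add: inverse_eq_divide)
      qed
      from this[OF that(1)] this[OF that(2)]
      have "2 * (J (y m) - d) + 2 * (J (y n) - d) < e\<^sup>2" by (simp add: field_simps)
      with para[OF y(1) y(1), of m n] have "(norm (y m - y n))\<^sup>2 < e\<^sup>2" by simp
      then show ?thesis using \<open>0 < e\<close> by (simp add: dist_norm power_less_imp_less_base)
    qed
    then show "\<exists>N. \<forall>m\<ge>N. \<forall>n\<ge>N. dist (y m) (y n) < e" by blast
  qed
  then obtain l where l: "y \<longlonglongrightarrow> l" using Cauchy_convergent convergent_def by blast
  have lM: "l \<in> M" using closed_sequentially[OF cl _ l] y(1) by blast
  have "J l \<le> d"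
  proof (rule LIMSEQ_le)
    show "(\<lambda>n. J (y n)) \<longlonglongrightarrow> J l" unfolding J_def by (intro tendsto_intros l f.tendsto)
    show "(\<lambda>n. d + 1 / Suc n) \<longlonglongrightarrow> d"
      using tendsto_add[OF tendsto_const[of d] LIMSEQ_inverse_real_of_nat]
      by (simp add: inverse_eq_divide)
    show "\<exists>N. \<forall>n\<ge>N. J (y n) \<le> d + 1 / real (Suc n)" using y(2) less_imp_le by blast
  qed
  have "inner l z = f z" if "z \<in> M" for z
  proof -
    \<comment> \<open>Minimality along the line through \<open>l\<close> in direction
      \<open>z\<close>; the linear coefficient is the defect in the wanted identity.\<close>
    have "0 \<le> 2 * t * (inner l z - f z) + t\<^sup>2 * (norm z)\<^sup>2" for t
    proof -
      have "l + t *\<^sub>R z \<in> M" using that lM sub by (simp add: subspace_add subspace_scale)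
      from d_le[OF this] \<open>J l \<le> d\<close> have "J l \<le> J (l + t *\<^sub>R z)" by linarith
      then show ?thesis
        unfolding J_def power2_norm_eq_inner
        by (simp add: f.add f.scaleR inner_add inner_commute power2_eq_square algebra_simps)
    qed
    from quadratic_nonneg_imp_zero[OF this] show ?thesis by simp
  qed
  then show ?thesis using that lM by blast
qed

lemma csubspace_imp_subspace: "csubspace M \<Longrightarrow> subspace (M :: 'a::chilbert_space set)"
  by (auto simp: complex_vector.subspace_def subspace_def scaleR_scaleC)

text \<open>The imaginary part of \<open>cinner x z\<close> is the real inner product with
  \<open>\<i> *\<^sub>C z\<close>, which again lies in the complex subspace.\<close>

lemma csubspace_cinner_eq_zeroI:
  assumes "csubspace M" "\<And>z. z \<in> M \<Longrightarrow> inner x z = 0" "z \<in> M"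
  shows "cinner x (z :: 'a::chilbert_space) = 0"
  using assms by (simp add: complex_eq_iff Re_cinner Im_cinner complex_vector.subspace_scale)

lemma orthogonal_projection_exists:
  assumes "closed_csubspace (M :: 'a::chilbert_space set)"
  shows "\<exists>y\<in>M. x - y \<in> ccomplement M"
proof -
  have M: "csubspace M" "closed M" using assms by (auto simp: closed_csubspace_def)
  obtain y where y: "y \<in> M" "\<And>z. z \<in> M \<Longrightarrow> inner y z = inner x z"
    using riesz_on_closed_subspace[OF csubspace_imp_subspace[OF M(1)] M(2)
        bounded_linear_inner_right[of x]] by metis
  then have "cinner (x - y) z = 0" if "z \<in> M" for z
    using M(1) that by (intro csubspace_cinner_eq_zeroI) (auto simp: inner_diff_left)
  with y(1) show ?thesis by (auto simp: ccomplement_def)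
qed

text \<open>Riesz represents the real functional \<open>inner (T x) y\<close>; complex linearity of
  \<open>T\<close> recovers the imaginary part from the real one at \<open>\<i> *\<^sub>C x\<close>.
  The bound on the adjoint comes from testing at \<open>S y\<close>.\<close>

lemma bounded_clinear_cadjoint_exists:
  fixes T :: "'a::chilbert_space \<Rightarrow> 'a"
  assumes T: "bounded_clinear T"
  obtains S where "is_cadjoint_on UNIV T S"
proof -
  interpret T: bounded_linear T using T by (simp add: bounded_clinear_def)
  have TC: "T (c *\<^sub>C x) = c *\<^sub>C T x" for c x using T by (simp add: bounded_clinear_def)
  have "\<exists>s. \<forall>x. cinner (T x) y = cinner x s" for y
  proof -
    have "bounded_linear (\<lambda>x. inner (T x) y)"
      using bounded_linear_compose[OF bounded_linear_inner_left T.bounded_linear_axioms] .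
    then obtain s where s: "\<And>x. inner s x = inner (T x) y"
      using riesz_on_closed_subspace[of UNIV] by (metis UNIV_I closed_UNIV subspace_UNIV)
    have "cinner (T x) y = cinner x s" for x
    proof (rule complex_eqI)
      show "Re (cinner (T x) y) = Re (cinner x s)" by (simp only: Re_cinner s[symmetric] inner_commute[of _ s])
      have Im: "Im (cinner u v) = - Re (cinner (\<i> *\<^sub>C u) v)" for u v :: 'a
        by (simp add: cinner_scaleC_left)
      show "Im (cinner (T x) y) = Im (cinner x s)"
        unfolding Im TC[symmetric] by (simp only: Re_cinner s[symmetric] inner_commute[of _ s])
    qed
    then show ?thesis by blast
  qed
  then obtain S where S: "\<And>x y. cinner (T x) y = cinner x (S y)" by metis
  have eqI: "u = v" if "\<And>x. cinner x u = cinner x v" for u v :: 'a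
    using that[of "u - v"] by (metis cinner_diff_right cinner_self_eq_zero eq_iff_diff_eq_0)
  obtain K where K: "\<And>x. norm (T x) \<le> norm x * K" "K > 0" using T.pos_bounded by blast
  have "bounded_clinear_on UNIV S"
    unfolding bounded_clinear_on_def
  proof (intro conjI ballI allI exI)
    show "S (x + y) = S x + S y" for x y
      by (rule eqI) (simp add: cinner_add_right flip: S)
    show "S (c *\<^sub>C x) = c *\<^sub>C S x" for c x
      by (rule eqI) (simp add: cinner_scaleC_right flip: S)
    show "norm (S y) \<le> norm y * K" for y
    proof (cases "S y = 0")
      case False
      have "(norm (S y))\<^sup>2 = cmod (cinner (T (S y)) y)" by (simp add: S cinner_self norm_power)
      also have "\<dots> \<le> norm (T (S y)) * norm y" by (rule norm_cinner_le)
      also have "\<dots> \<le> (norm (S y) * K) * norm y" by (intro mult_right_mono K) auto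
      finally show ?thesis using False by (simp add: power2_eq_square mult_ac)
    qed (use K in auto)
  qed auto
  then show ?thesis using S by (intro that[of S]) (simp add: is_cadjoint_on_def)
qed

lemma cadjoint_eqI:
  assumes "is_cadjoint_on UNIV T (S :: 'a::chilbert_space \<Rightarrow> 'a)"
  shows "cadjoint T = S"
  unfolding cadjoint_def
proof (rule the_equality)
  fix R assume "is_cadjoint_on UNIV T R"
  with assms have "cinner x (R y) = cinner x (S y)" for x y by (auto simp: is_cadjoint_on_def)
  then have "cinner (R y - S y) (R y - S y) = 0" for y by (simp only: cinner_diff_right) simp
  then show "R = S" by auto
qed fact

section \<open>Diagonal operators\<close>

lemma closed_csubspaceD:
  assumes "closed_csubspace (M :: 'a::chilbert_space set)"
  shows "0 \<in> M" "x \<in> M \<Longrightarrow> y \<in> M \<Longrightarrow> x + y \<in> M" "x \<in> M \<Longrightarrow> y \<in> M \<Longrightarrow> x - y \<in> M"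
    "x \<in> M \<Longrightarrow> c *\<^sub>C x \<in> M" "x \<in> M \<Longrightarrow> r *\<^sub>R x \<in> M" "closed M"
  using assms unfolding closed_csubspace_def scaleR_scaleC
  by (auto intro: complex_vector.subspace_0 complex_vector.subspace_add
      complex_vector.subspace_diff complex_vector.subspace_scale)

lemma has_sum_in_closed_csubspace:
  assumes M: "closed_csubspace (M :: 'a::chilbert_space set)"
    and "(f has_sum x) I" "\<And>i. i \<in> I \<Longrightarrow> f i \<in> M"
  shows "x \<in> M"
proof (rule Lim_in_closed_set[OF closed_csubspaceD(6)[OF M]])
  show "(sum f \<longlongrightarrow> x) (finite_subsets_at_top I)" using assms(2) by (simp add: has_sum_def)
  have "csubspace M" using M by (simp add: closed_csubspace_def)
  then show "\<forall>\<^sub>F F in finite_subsets_at_top I. sum f F \<in> M"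
    using assms(3) by (intro eventually_finite_subsets_at_top_weakI complex_vector.subspace_sum) auto
qed simp

lemma ccomplementI: "(\<And>y. y \<in> M \<Longrightarrow> cinner x y = 0) \<Longrightarrow> x \<in> ccomplement M"
  by (simp add: ccomplement_def)

lemma ccomplementD: "x \<in> ccomplement M \<Longrightarrow> y \<in> M \<Longrightarrow> cinner x y = 0"
  by (simp add: ccomplement_def)

lemma ccomplement_UN: "ccomplement (\<Union>i\<in>I. M i) = (\<Inter>i\<in>I. ccomplement (M i))"
  by (auto simp: ccomplement_def)

text \<open>The components \<open>f i\<close> of \<open>x\<close> are summable by Bessel's inequality, and the difference of
  \<open>x\<close> and their sum is orthogonal to itself.\<close>

lemma orthogonal_components_has_sum:
  fixes M :: "'i \<Rightarrow> 'a::chilbert_space set"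
  assumes orth: "\<And>i j. i \<noteq> j \<Longrightarrow> corthogonal (M i) (M j)"
    and f: "\<And>i. f i \<in> M i" "\<And>i. x - f i \<in> ccomplement (M i)"
    and x: "x \<in> ccomplement (ccomplement (\<Union>i. M i))"
  shows "(f has_sum x) UNIV"
proof -
  have forth: "cinner (f i) (f j) = 0" if "i \<noteq> j" for i j
    using orth[OF that] f(1) by (auto simp: corthogonal_def)
  have xf: "cinner x (f i) = of_real ((norm (f i))\<^sup>2)" for i
    using ccomplementD[OF f(2) f(1), of i] by (simp add: cinner_diff_left cinner_self)
  have bessel: "(\<Sum>i\<in>F. (norm (f i))\<^sup>2) \<le> (norm x)\<^sup>2" if "finite F" for F
  proof -
    let ?s = "\<Sum>i\<in>F. f i"
    have n: "(norm ?s)\<^sup>2 = (\<Sum>i\<in>F. (norm (f i))\<^sup>2)"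
      using that forth by (intro norm_sum_sq_orthogonal) auto
    have "cinner x ?s = (\<Sum>i\<in>F. cinner x (f i))"
      by (rule bounded_linear.linear[OF bounded_linear_cinner_right, THEN linear_sum])
    also have "\<dots> = cinner ?s ?s" by (simp add: xf cinner_self n del: of_real_power)
    finally have "cinner (x - ?s) ?s = 0" by (simp add: cinner_diff_left)
    from norm_add_sq_orthogonal[OF this] show ?thesis using n by simp
  qed
  have "(\<lambda>i. (norm (f i))\<^sup>2) summable_on UNIV"
    using bessel by (intro nonneg_bdd_above_summable_on) (auto intro!: bdd_aboveI2)
  then have "f summable_on UNIV"
    using forth by (intro summable_on_orthogonal) auto
  then obtain y where y: "(f has_sum y) UNIV" by (auto simp: summable_on_def)
  have "cinner (x - y) z = 0" if "z \<in> M i" for i z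
  proof -
    have "((\<lambda>j. cinner (f j) z) has_sum cinner y z) UNIV" by (rule has_sum_cinner_left[OF y])
    moreover have "((\<lambda>j. cinner (f j) z) has_sum cinner (f i) z) UNIV"
      using orth f(1) that
      by (intro has_sum_finite_neutralI[of "{i}"]) (auto simp: corthogonal_def)
    ultimately have "cinner y z = cinner (f i) z" by (rule has_sum_unique)
    then show ?thesis using ccomplementD[OF f(2) that] by (simp add: cinner_diff_left)
  qed
  then have perp: "x - y \<in> ccomplement (\<Union>i. M i)" by (auto intro!: ccomplementI)
  have "f i \<in> ccomplement (ccomplement (\<Union>i. M i))" for i
    using f(1)[of i] by (auto intro!: ccomplementI simp: ccomplement_def cinner_eq_zero_sym[of "f i"])
  then have "y \<in> ccomplement (ccomplement (\<Union>i. M i))"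
    by (intro has_sum_in_closed_csubspace[OF closed_csubspace_ccomplement y])
  then have "x - y \<in> ccomplement (ccomplement (\<Union>i. M i))"
    using x closed_csubspaceD(3)[OF closed_csubspace_ccomplement] by blast
  from ccomplementD[OF this perp] have "x = y" by simp
  with y show ?thesis by simp
qed

lemma bounded_clinearI:
  fixes A :: "'a::chilbert_space \<Rightarrow> 'a"
  assumes "\<And>x y. A (x + y) = A x + A y" "\<And>c x. A (c *\<^sub>C x) = c *\<^sub>C A x"
    "\<And>x. norm (A x) \<le> norm x * K"
  shows "bounded_clinear A"
  using assms by (auto simp: bounded_clinear_on_def simp flip: bounded_clinear_on_UNIV)

text \<open>The whole type is the index set and members may be trivial, so the eigenspaces can be
  indexed by all reals without choosing eigenvalues in advance.\<close>

locale total_orthogonal_family =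
  fixes E :: "'i \<Rightarrow> 'a::chilbert_space set"
  assumes closed_csubspace_E: "closed_csubspace (E i)"
    and orthogonal_E: "i \<noteq> j \<Longrightarrow> corthogonal (E i) (E j)"
    and total_E: "ccomplement (\<Union>i. E i) \<subseteq> {0}"
begin

definition component :: "'i \<Rightarrow> 'a \<Rightarrow> 'a" where
  "component i x = (SOME y. y \<in> E i \<and> x - y \<in> ccomplement (E i))"

text \<open>The spectral subspace of \<open>S\<close>, that is, the closed span of the
  \<open>E i\<close> with \<open>i\<close> in \<open>S\<close>; written as a complement it is closed
  by construction.\<close>

definition spec :: "'i set \<Rightarrow> 'a set" where
  "spec S = ccomplement (\<Union>i\<in>-S. E i)"

definition diag :: "('i \<Rightarrow> complex) \<Rightarrow> 'a \<Rightarrow> 'a" where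
  "diag g x = infsum (\<lambda>i. g i *\<^sub>C component i x) UNIV"

text \<open>Only the values of \<open>g\<close> at indices of nontrivial subspaces matter for \<^term>\<open>diag g\<close>.\<close>

definition bounded_symbol :: "('i \<Rightarrow> complex) \<Rightarrow> bool" where
  "bounded_symbol g \<longleftrightarrow> (\<exists>K. \<forall>i. E i \<noteq> {0} \<longrightarrow> cmod (g i) \<le> K)"

lemma component_in: "component i x \<in> E i" and component_perp: "x - component i x \<in> ccomplement (E i)"
  using someI_ex[OF orthogonal_projection_exists[OF closed_csubspace_E, unfolded Bex_def], of i x]
  by (auto simp: component_def)

lemma cinner_E: "i \<noteq> j \<Longrightarrow> x \<in> E i \<Longrightarrow> y \<in> E j \<Longrightarrow> cinner x y = 0"
  using orthogonal_E by (auto simp: corthogonal_def)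

lemma cinner_component: "y \<in> E i \<Longrightarrow> cinner (component i x) y = cinner x y"
  using ccomplementD[OF component_perp, of y i x] by (simp add: cinner_diff_left)

lemma component_unique:
  assumes "y \<in> E i" "x - y \<in> ccomplement (E i)"
  shows "component i x = y"
proof -
  have "component i x - y \<in> E i" using closed_csubspaceD(3)[OF closed_csubspace_E] component_in assms(1) .
  moreover have "(x - y) - (x - component i x) \<in> ccomplement (E i)"
    by (intro closed_csubspaceD(3)[OF closed_csubspace_ccomplement] assms component_perp)
  ultimately have "cinner (component i x - y) (component i x - y) = 0"
    by (intro ccomplementD[of _ "E i"]) simp_all
  then show ?thesis by simp
qed

lemma component_has_sum: "((\<lambda>i. component i x) has_sum x) UNIV"
proof (rule orthogonal_components_has_sum[OF orthogonal_E component_in component_perp])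
  show "x \<in> ccomplement (ccomplement (\<Union>i. E i))"
    using total_E by (auto simp: ccomplement_def[of "ccomplement _"])
qed

text \<open>Pairing the series with a vector of \<open>E i\<close> leaves a single term. Components
  of sums, multiples and diagonal images are thus read off from any expansion.\<close>

lemma component_eqI:
  assumes f: "\<And>i. f i \<in> E i" and sum: "(f has_sum x) UNIV"
  shows "component i x = f i"
proof (rule component_unique[OF f ccomplementI])
  fix z assume z: "z \<in> E i"
  have "((\<lambda>j. cinner (f j) z) has_sum cinner x z) UNIV" by (rule has_sum_cinner_left[OF sum])
  moreover have "((\<lambda>j. cinner (f j) z) has_sum cinner (f i) z) UNIV"
    using cinner_E[OF _ f z] by (intro has_sum_finite_neutralI[of "{i}"]) auto
  ultimately have "cinner x z = cinner (f i) z" by (rule has_sum_unique)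
  then show "cinner (x - f i) z = 0" by (simp add: cinner_diff_left)
qed

lemma component_ext: "(\<And>i. component i x = component i y) \<Longrightarrow> x = y"
  using component_has_sum[of x] component_has_sum[of y] by (simp add: has_sum_unique)

lemma norm_component_has_sum: "((\<lambda>i. (norm (component i x))\<^sup>2) has_sum (norm x)\<^sup>2) UNIV"
  using cinner_E[OF _ component_in component_in] by (intro has_sum_norm_sq_orthogonal component_has_sum) auto

lemma component_add: "component i (x + y) = component i x + component i y"
  by (rule component_eqI[OF closed_csubspaceD(2)[OF closed_csubspace_E component_in component_in]
        has_sum_add[OF component_has_sum component_has_sum]])

lemma component_scaleC: "component i (c *\<^sub>C x) = c *\<^sub>C component i x"
  by (rule component_eqI[OF closed_csubspaceD(4)[OF closed_csubspace_E component_in]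
        has_sum_bounded_linear[OF bounded_linear_scaleC component_has_sum]])

lemma component_E: "x \<in> E i \<Longrightarrow> component i x = x"
  by (rule component_unique) (simp_all add: ccomplement_def)

lemma component_E_other: "x \<in> E i \<Longrightarrow> i \<noteq> j \<Longrightarrow> component j x = 0"
  by (rule component_unique) (auto simp: closed_csubspaceD[OF closed_csubspace_E] ccomplement_def cinner_E)

lemma component_eq_zero_iff: "component i x = 0 \<longleftrightarrow> x \<in> ccomplement (E i)"
  using component_perp[of x i] component_unique[of 0 i x] closed_csubspaceD(1)[OF closed_csubspace_E] by auto

lemma spec_iff: "x \<in> spec S \<longleftrightarrow> (\<forall>i. i \<notin> S \<longrightarrow> component i x = 0)"
  by (auto simp: spec_def ccomplement_UN component_eq_zero_iff)

lemma closed_csubspace_spec: "closed_csubspace (spec S)"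
  by (simp add: spec_def closed_csubspace_ccomplement)

lemma spec_mono: "S \<subseteq> S' \<Longrightarrow> spec S \<subseteq> spec S'"
  by (auto simp: spec_iff subset_iff)

lemma E_subset_spec: "i \<in> S \<Longrightarrow> E i \<subseteq> spec S"
  by (auto simp: spec_iff intro: component_E_other)

lemma spec_singleton: "spec {i} = E i"
proof
  show "spec {i} \<subseteq> E i"
  proof
    fix x assume "x \<in> spec {i}"
    then have "component j x = component j (component i x)" for j
      by (cases "j = i") (auto simp: spec_iff component_E component_in component_E_other[OF component_in])
    then have "x = component i x" by (rule component_ext)
    then show "x \<in> E i" by (metis component_in)
  qed
qed (simp add: E_subset_spec)

lemma spec_empty: "spec {} = {0}"
proof -
  have "component i 0 = 0" for i using component_scaleC[of i 0 0] by simp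
  then show ?thesis
    using component_ext[of _ 0] by (auto simp: spec_iff)
qed

text \<open>Components in a trivial \<open>E i\<close> vanish anyway. This converts a gap between
  eigenvalues into an equality of spectral subspaces.\<close>

lemma spec_cong:
  assumes "\<And>i. E i \<noteq> {0} \<Longrightarrow> i \<in> S \<longleftrightarrow> i \<in> S'"
  shows "spec S = spec S'"
proof -
  have "component i x = 0" if "E i = {0}" for i x using component_in[of i x] that by auto
  then show ?thesis using assms by (auto simp: spec_iff) metis+
qed

lemma corthogonal_spec:
  assumes "S \<inter> S' = {}"
  shows "corthogonal (spec S) (spec S')"
  unfolding corthogonal_def
proof (intro ballI)
  fix x y assume xy: "x \<in> spec S" "y \<in> spec S'"
  have "cinner (component i x) y = 0" for i
  proof (cases "i \<in> S")
    case True
    then have "y \<in> ccomplement (E i)"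
      using xy(2) assms component_eq_zero_iff by (auto simp: spec_iff)
    then show ?thesis using component_in by (metis ccomplementD cinner_eq_zero_sym)
  qed (use xy in \<open>auto simp: spec_iff\<close>)
  then have "((\<lambda>i :: 'i. 0 :: complex) has_sum cinner x y) UNIV"
    using has_sum_cinner_left[OF component_has_sum[of x], of y] by simp
  from has_sum_unique[OF this has_sum_0_simp] show "cinner x y = 0" .
qed

text \<open>The projection of \<open>x\<close> onto \<open>spec S\<close> accounts for all
  components with index in \<open>S\<close>, so the remainder lives on \<open>S'\<close>.\<close>

lemma spec_split:
  assumes "x \<in> spec (S \<union> S')" "S \<inter> S' = {}"
  obtains y z where "y \<in> spec S" "z \<in> spec S'" "x = y + z"
proof -
  obtain y where y: "y \<in> spec S" "x - y \<in> ccomplement (spec S)"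
    using orthogonal_projection_exists[OF closed_csubspace_spec] by blast
  have "component i (x - y) = 0" if "i \<notin> S'" for i
  proof (cases "i \<in> S")
    case True
    then show ?thesis
      using y(2) E_subset_spec[of i S] by (auto simp: component_eq_zero_iff ccomplement_def)
  next
    case False
    then have "x \<in> ccomplement (E i)" "y \<in> ccomplement (E i)"
      using assms(1) y(1) that by (auto simp: spec_iff simp flip: component_eq_zero_iff)
    then show ?thesis
      unfolding component_eq_zero_iff by (rule closed_csubspaceD(3)[OF closed_csubspace_ccomplement])
  qed
  then have "x - y \<in> spec S'" by (simp add: spec_iff)
  from that[OF y(1) this] show ?thesis by simp
qed

text \<open>Since \<open>S'\<close> may drop trivial members of \<open>S\<close>, a half-line of
  reals can be replaced by the eigenvalues in it.\<close>

lemma is_hilbert_sum_spec: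
  assumes "\<And>i. i \<in> S \<Longrightarrow> E i \<noteq> {0} \<Longrightarrow> i \<in> S'" "S' \<subseteq> S"
  shows "is_hilbert_sum S' E (spec S)"
  unfolding is_hilbert_sum_def
proof (intro conjI ballI impI closed_csubspace_E orthogonal_E set_eqI iffI)
  fix x assume "x \<in> spec S"
  then have zero: "component i x = 0" if "i \<notin> S'" for i
    using assms(1)[of i] that component_in[of i x] by (cases "i \<in> S") (auto simp: spec_iff)
  have "((\<lambda>i. component i x) has_sum x) UNIV \<longleftrightarrow> ((\<lambda>i. component i x) has_sum x) S'"
    by (rule has_sum_cong_neutral) (use zero in auto)
  with component_has_sum have "((\<lambda>i. component i x) has_sum x) S'" by blast
  then show "x \<in> {x. \<exists>f. (\<forall>i\<in>S'. f i \<in> E i) \<and> (f has_sum x) S'}"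
    using component_in by (intro CollectI exI[of _ "\<lambda>i. component i x"]) blast
next
  fix x assume "x \<in> {x. \<exists>f. (\<forall>i\<in>S'. f i \<in> E i) \<and> (f has_sum x) S'}"
  then obtain f where f: "\<And>i. i \<in> S' \<Longrightarrow> f i \<in> E i" "(f has_sum x) S'" by blast
  have "f i \<in> spec S" if "i \<in> S'" for i
    using E_subset_spec[of i S] f(1)[OF that] assms(2) that by blast
  with f(2) show "x \<in> spec S" by (rule has_sum_in_closed_csubspace[OF closed_csubspace_spec])
qed

section \<open>Calculus of bounded symbols and their diagonal operators\<close>

lemma norm_symbol_sq_le:
  assumes "E i \<noteq> {0} \<Longrightarrow> cmod (g i) \<le> K"
  shows "(norm (g i *\<^sub>C component i x))\<^sup>2 \<le> K\<^sup>2 * (norm (component i x))\<^sup>2"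
proof (cases "E i = {0}")
  case True
  then show ?thesis using component_in[of i x] by auto
next
  case False
  from power_mono[OF assms[OF this], of 2] show ?thesis
    by (auto simp: power_mult_distrib intro!: mult_right_mono)
qed

lemma diag_has_sum:
  assumes "bounded_symbol g"
  shows "((\<lambda>i. g i *\<^sub>C component i x) has_sum diag g x) UNIV"
proof -
  obtain K where K: "\<And>i. E i \<noteq> {0} \<Longrightarrow> cmod (g i) \<le> K"
    using assms by (auto simp: bounded_symbol_def)
  have sq: "(norm (g i *\<^sub>C component i x))\<^sup>2 \<le> K\<^sup>2 * (norm (component i x))\<^sup>2" for i
    by (rule norm_symbol_sq_le[OF K])
  have "(\<lambda>i. K\<^sup>2 * (norm (component i x))\<^sup>2) summable_on UNIV"
    using has_sum_cmult_right[OF norm_component_has_sum] unfolding summable_on_def by blast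
  then have "(\<lambda>i. (norm (g i *\<^sub>C component i x))\<^sup>2) summable_on UNIV"
    by (rule summable_on_comparison_test) (use sq in auto)
  moreover have "cinner (g i *\<^sub>C component i x) (g j *\<^sub>C component j x) = 0" if "i \<noteq> j" for i j
    using cinner_E[OF that component_in component_in] by (simp add: cinner_scaleC_left cinner_scaleC_right)
  ultimately have "(\<lambda>i. g i *\<^sub>C component i x) summable_on UNIV"
    by (intro summable_on_orthogonal) auto
  then show ?thesis unfolding diag_def by (rule has_sum_infsum)
qed

lemma component_diag:
  assumes "bounded_symbol g"
  shows "component i (diag g x) = g i *\<^sub>C component i x"
  by (rule component_eqI[OF closed_csubspaceD(4)[OF closed_csubspace_E component_in] diag_has_sum[OF assms]])

lemma bounded_clinear_diag:
  assumes "bounded_symbol g"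
  shows "bounded_clinear (diag g)"
proof -
  obtain K where K: "\<And>i. E i \<noteq> {0} \<Longrightarrow> cmod (g i) \<le> K"
    using assms by (auto simp: bounded_symbol_def)
  show ?thesis
  proof (rule bounded_clinearI[where K = "\<bar>K\<bar>"])
    show "diag g (x + y) = diag g x + diag g y" for x y
      by (rule component_ext) (simp add: component_add component_diag[OF assms] scaleC_add_right)
    show "diag g (c *\<^sub>C x) = c *\<^sub>C diag g x" for c x
      by (rule component_ext) (simp add: component_scaleC component_diag[OF assms] scaleC_scaleC mult_ac)
    show "norm (diag g x) \<le> norm x * \<bar>K\<bar>" for x
    proof (rule power2_le_imp_le)
      have "((\<lambda>i. (norm (g i *\<^sub>C component i x))\<^sup>2) has_sum (norm (diag g x))\<^sup>2) UNIV"
        using norm_component_has_sum[of "diag g x"] by (simp only: component_diag[OF assms])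
      moreover have "((\<lambda>i. K\<^sup>2 * (norm (component i x))\<^sup>2) has_sum K\<^sup>2 * (norm x)\<^sup>2) UNIV"
        by (rule has_sum_cmult_right[OF norm_component_has_sum])
      moreover have "(norm (g i *\<^sub>C component i x))\<^sup>2 \<le> K\<^sup>2 * (norm (component i x))\<^sup>2" for i
        by (rule norm_symbol_sq_le[OF K])
      ultimately have "(norm (diag g x))\<^sup>2 \<le> K\<^sup>2 * (norm x)\<^sup>2" by (rule has_sum_mono)
      then show "(norm (diag g x))\<^sup>2 \<le> (norm x * \<bar>K\<bar>)\<^sup>2" by (simp add: power_mult_distrib mult.commute)
    qed simp
  qed
qed

lemma bounded_symbol_mult:
  assumes "bounded_symbol g" "bounded_symbol h"
  shows "bounded_symbol (\<lambda>i. g i * h i)"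
proof -
  obtain K L where KL: "\<And>i. E i \<noteq> {0} \<Longrightarrow> cmod (g i) \<le> K" "\<And>i. E i \<noteq> {0} \<Longrightarrow> cmod (h i) \<le> L"
    using assms by (auto simp: bounded_symbol_def)
  have "cmod (g i * h i) \<le> \<bar>K\<bar> * \<bar>L\<bar>" if "E i \<noteq> {0}" for i
    using KL[OF that] by (auto simp: norm_mult intro!: mult_mono)
  then show ?thesis by (auto simp: bounded_symbol_def)
qed

lemma bounded_symbol_diff_const:
  assumes "bounded_symbol g"
  shows "bounded_symbol (\<lambda>i. g i - c)"
proof -
  obtain K where K: "\<And>i. E i \<noteq> {0} \<Longrightarrow> cmod (g i) \<le> K"
    using assms by (auto simp: bounded_symbol_def)
  have "cmod (g i - c) \<le> K + cmod c" if "E i \<noteq> {0}" for i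
    using K[OF that] norm_triangle_ineq4[of "g i" c] by linarith
  then show ?thesis by (auto simp: bounded_symbol_def)
qed

lemma diag_diag:
  assumes "bounded_symbol g" "bounded_symbol h"
  shows "diag g (diag h x) = diag (\<lambda>i. g i * h i) x"
  by (rule component_ext) (simp add: component_diag assms bounded_symbol_mult scaleC_scaleC)

text \<open>A bounded operator passes through the expansion of \<open>x\<close>, so its action on
  each \<open>E i\<close> determines it. Shifts, \<open>S \<circ> T\<close> and every positive
  square root of it are identified in this way.\<close>

lemma diag_eqI:
  assumes "bounded_symbol g" "bounded_linear A" "\<And>i y. y \<in> E i \<Longrightarrow> A y = g i *\<^sub>C y"
  shows "A x = diag g x"
  using has_sum_bounded_linear[OF assms(2) component_has_sum[of x]] diag_has_sum[OF assms(1), of x]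
  by (simp add: assms(3)[OF component_in] has_sum_unique)

lemma diag_E:
  assumes "bounded_symbol g" "y \<in> E i"
  shows "diag g y = g i *\<^sub>C y"
  by (rule component_ext)
     (metis assms component_diag component_E_other component_scaleC complex_vector.scale_zero_right component_E)

lemma diag_one: "(\<And>i. E i \<noteq> {0} \<Longrightarrow> g i = 1) \<Longrightarrow> diag g x = x"
proof -
  assume g: "\<And>i. E i \<noteq> {0} \<Longrightarrow> g i = 1"
  then have "bounded_symbol g" unfolding bounded_symbol_def by (intro exI[of _ 1]) auto
  then have "(\<lambda>y. y) x = diag g x"
  proof (rule diag_eqI)
    show "y = g i *\<^sub>C y" if "y \<in> E i" for i y
      using that g by (cases "E i = {0}") (auto simp: scaleC_one)
  qed simp
  then show "diag g x = x" by simp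
qed

lemma op_shift_diag:
  assumes "bounded_symbol g"
  shows "op_shift (diag g) c = diag (\<lambda>i. g i - c)"
proof
  have D: "bounded_linear (diag g)" using bounded_clinear_diag[OF assms] by (simp add: bounded_clinear_def)
  show "op_shift (diag g) c x = diag (\<lambda>i. g i - c) x" for x
  proof (rule diag_eqI[OF bounded_symbol_diff_const[OF assms]])
    show "bounded_linear (op_shift (diag g) c)"
      unfolding op_shift_def by (rule bounded_linear_sub[OF D bounded_linear_scaleC])
  qed (simp add: op_shift_def diag_E[OF assms] complex_vector.scale_left_diff_distrib)
qed

lemma null_space_diag:
  assumes "bounded_symbol g"
  shows "null_space (diag g) = spec {i. g i = 0}"
proof -
  have "component i 0 = 0" for i using spec_empty spec_iff[of 0 "{}"] by auto
  then have "diag g x = 0 \<longleftrightarrow> (\<forall>i. component i (diag g x) = 0)" for x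
    using component_ext[of "diag g x" 0] by auto
  then have "diag g x = 0 \<longleftrightarrow> (\<forall>i. g i = 0 \<or> component i x = 0)" for x
    by (simp add: component_diag[OF assms])
  then show ?thesis
    by (auto simp: null_space_def spec_iff complex_vector.scale_eq_0_iff)
qed

lemma cinner_diag_has_sum:
  assumes "bounded_symbol g"
  shows "((\<lambda>i. g i * cinner (component i x) (component i y)) has_sum cinner (diag g x) y) UNIV"
proof -
  have "cinner (component i x) y = cinner (component i x) (component i y)" for i
    using arg_cong[OF cinner_component[OF component_in[of i x], of y], of cnj]
    by (simp flip: cinner_commute)
  then show ?thesis
    using has_sum_cinner_left[OF diag_has_sum[OF assms], of x y] by (simp add: cinner_scaleC_left)
qed

lemma cadjoint_diag:
  assumes g: "bounded_symbol g"
  shows "cadjoint (diag g) = diag (\<lambda>i. cnj (g i))"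
proof (rule cadjoint_eqI)
  have g': "bounded_symbol (\<lambda>i. cnj (g i))" using g by (simp add: bounded_symbol_def)
  have "cinner (diag g x) y = cinner x (diag (\<lambda>i. cnj (g i)) y)" for x y
  proof -
    have "((\<lambda>i. cnj (cnj (g i) * cinner (component i y) (component i x))) has_sum
        cnj (cinner (diag (\<lambda>i. cnj (g i)) y) x)) UNIV"
      by (rule has_sum_bounded_linear[OF bounded_linear_cnj cinner_diag_has_sum[OF g']])
    then have "((\<lambda>i. g i * cinner (component i x) (component i y)) has_sum
        cinner x (diag (\<lambda>i. cnj (g i)) y)) UNIV"
      by (simp flip: cinner_commute)
    then show ?thesis using cinner_diag_has_sum[OF g] has_sum_unique by blast
  qed
  then show "is_cadjoint_on UNIV (diag g) (diag (\<lambda>i. cnj (g i)))"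
    using bounded_clinear_diag[OF g'] by (simp add: is_cadjoint_on_def bounded_clinear_on_UNIV)
qed

lemma bounded_symbol_inverse:
  assumes "0 < d" "\<And>i. E i \<noteq> {0} \<Longrightarrow> g i \<noteq> 0 \<Longrightarrow> d \<le> cmod (g i)"
  shows "bounded_symbol (\<lambda>i. inverse (g i))"
  unfolding bounded_symbol_def
proof (intro exI[of _ "inverse d"] allI impI)
  fix i assume i: "E i \<noteq> {0}"
  show "cmod (inverse (g i)) \<le> inverse d"
    using assms(1) assms(2)[OF i] by (cases "g i = 0") (auto simp: norm_inverse le_imp_inverse_le)
qed

text \<open>As \<open>inverse 0 = 0\<close>, the symbol \<open>g i * inverse (g i)\<close> takes
  only the values 0 and 1, and the range is the fixed space of its bounded diagonal
  operator.\<close>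

lemma closed_range_diag:
  assumes g: "bounded_symbol g" and d: "0 < d" "\<And>i. E i \<noteq> {0} \<Longrightarrow> g i \<noteq> 0 \<Longrightarrow> d \<le> cmod (g i)"
  shows "closed (range (diag g))"
proof -
  let ?h = "\<lambda>i. inverse (g i)"
  have h: "bounded_symbol ?h" by (rule bounded_symbol_inverse[OF d])
  have "range (diag g) = {y. diag (\<lambda>i. g i * ?h i) y = y}"
  proof (intro equalityI subsetI)
    fix y assume "y \<in> range (diag g)"
    then obtain x where "y = diag g x" by auto
    moreover have "(\<lambda>i. g i * inverse (g i) * g i) = g" proof
      show "g i * inverse (g i) * g i = g i" for i by (cases "g i = 0") simp_all
    qed
    ultimately show "y \<in> {y. diag (\<lambda>i. g i * ?h i) y = y}"
      using g h by (simp add: diag_diag bounded_symbol_mult)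
  next
    fix y assume "y \<in> {y. diag (\<lambda>i. g i * ?h i) y = y}"
    then show "y \<in> range (diag g)" using g h by (metis (mono_tags) diag_diag mem_Collect_eq rangeI)
  qed
  moreover have "bounded_linear (diag (\<lambda>i. g i * ?h i))"
    using bounded_clinear_diag[OF bounded_symbol_mult[OF g h]] by (simp add: bounded_clinear_def)
  ultimately show ?thesis
    by (auto intro!: closed_Collect_eq linear_continuous_on continuous_on_id)
qed

lemma invertible_diag:
  assumes g: "bounded_symbol g" and d: "0 < d" "\<And>i. E i \<noteq> {0} \<Longrightarrow> d \<le> cmod (g i)"
  shows "invertible_op (diag g)"
proof -
  let ?h = "\<lambda>i. inverse (g i)"
  have h: "bounded_symbol ?h" using d by (intro bounded_symbol_inverse) auto
  have "g i \<noteq> 0" if "E i \<noteq> {0}" for i using d(1) d(2)[OF that] by auto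
  then have "?h i * g i = 1" "g i * ?h i = 1" if "E i \<noteq> {0}" for i using that by simp_all
  then have "diag (\<lambda>i. ?h i * g i) = id" "diag (\<lambda>i. g i * ?h i) = id"
    by (auto simp: fun_eq_iff intro!: diag_one)
  moreover have "diag ?h \<circ> diag g = diag (\<lambda>i. ?h i * g i)"
    "diag g \<circ> diag ?h = diag (\<lambda>i. g i * ?h i)"
    using g h by (auto simp: fun_eq_iff diag_diag)
  ultimately show ?thesis
    using bounded_clinear_diag[OF h] unfolding invertible_op_def by metis
qed

end

section \<open>Eigenspaces of the operator \<open>T\<^sup>* T\<close>\<close>

lemma cfinite_dim_subset: "cfinite_dim N \<Longrightarrow> M \<subseteq> N \<Longrightarrow> cfinite_dim M"
  unfolding cfinite_dim_def by blast

lemma cfinite_dim_zero: "cfinite_dim ({0} :: 'a::complex_vector set)"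
  unfolding cfinite_dim_def by (intro exI[of _ "{}"]) simp

text \<open>Orthogonality to one vector costs at most one dimension: any \<open>u\<close> in
  \<open>X\<close> not orthogonal to \<open>w\<close> spans \<open>X\<close> together with the
  rest.\<close>

lemma cfinite_dim_Int_ccomplement_insert:
  fixes X :: "'a::chilbert_space set"
  assumes X: "csubspace X" and fin: "cfinite_dim (X \<inter> ccomplement {w})"
  shows "cfinite_dim X"
proof (cases "X \<subseteq> ccomplement {w}")
  case True
  then show ?thesis using fin by (simp add: Int_absorb2)
next
  case False
  then obtain u where u: "u \<in> X" "cinner u w \<noteq> 0" by (auto simp: ccomplement_def)
  obtain B where B: "finite B" "X \<inter> ccomplement {w} \<subseteq> cspan B"
    using fin by (auto simp: cfinite_dim_def)
  have "x \<in> cspan (insert u B)" if x: "x \<in> X" for x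
  proof -
    define c where "c = cinner x w / cinner u w"
    have "x - c *\<^sub>C u \<in> X"
      using X x u by (intro complex_vector.subspace_diff complex_vector.subspace_scale)
    moreover have "cinner (x - c *\<^sub>C u) w = 0"
      using u by (simp add: c_def cinner_diff_left cinner_scaleC_left)
    ultimately have "x - c *\<^sub>C u \<in> cspan B" using B by (auto simp: ccomplement_def)
    then show ?thesis by (auto simp: complex_vector.span_insert)
  qed
  then show ?thesis using B(1) unfolding cfinite_dim_def by (intro exI[of _ "insert u B"]) auto
qed

text \<open>Finitely many orthogonality conditions leave an infinite-dimensional subspace. This
  supplies the next vector in the sequences built later.\<close>

lemma exists_unit_orthogonal:
  fixes X :: "'a::chilbert_space set"
  assumes X: "csubspace X" and inf: "\<not> cfinite_dim X" and "finite W"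
  obtains x where "x \<in> X" "norm x = 1" "\<And>w. w \<in> W \<Longrightarrow> cinner x w = 0"
proof -
  have "\<not> cfinite_dim (X \<inter> ccomplement W)"
    using \<open>finite W\<close>
  proof (induction W)
    case empty
    then show ?case using inf by (simp add: ccomplement_def)
  next
    case (insert w W)
    have "X \<inter> ccomplement (insert w W) = (X \<inter> ccomplement W) \<inter> ccomplement {w}"
      by (auto simp: ccomplement_def)
    moreover have "csubspace (X \<inter> ccomplement W)"
      using X csubspace_ccomplement by (rule complex_vector.subspace_inter)
    ultimately show ?case using insert.IH cfinite_dim_Int_ccomplement_insert by metis
  qed
  then obtain x where x: "x \<in> X" "x \<in> ccomplement W" "x \<noteq> 0"
    using cfinite_dim_subset[OF cfinite_dim_zero] by blast
  define y where "y = complex_of_real (inverse (norm x)) *\<^sub>C x"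
  show ?thesis
  proof (rule that[of y])
    show "y \<in> X" using X x(1) by (simp add: y_def complex_vector.subspace_scale)
    show "norm y = 1" using x(3) by (simp add: y_def norm_inverse)
    show "cinner y w = 0" if "w \<in> W" for w
      using ccomplementD[OF x(2) that] by (simp add: y_def cinner_scaleC_left)
  qed
qed

text \<open>The adjoint is a parameter \<open>S\<close> given by its characteristic identity, which
  keeps the definite description \<open>cadjoint\<close> out of the analysis; \<open>comm\<close> is
  quasinormality, pointwise.\<close>

locale an_quasinormal =
  fixes T S :: "'a::chilbert_space \<Rightarrow> 'a"
  assumes AN: "absolutely_norm_attaining T"
    and adj: "is_cadjoint_on UNIV T S"
    and comm: "T (S (T x)) = S (T (T x))"
begin

text \<open>The eigenspace \<open>N(|T| - r I)\<close>, written without \<open>|T|\<close>. It is set to \<open>{0}\<close> for \<open>r < 0\<close>, because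
  \<open>r\<close> and \<open>- r\<close> have the same square.\<close>

definition eig :: "real \<Rightarrow> 'a set" where
  "eig r = (if 0 \<le> r then {x. S (T x) = r\<^sup>2 *\<^sub>R x} else {0})"

lemma bounded_clinear_T: "bounded_clinear T"
  using AN by (simp add: absolutely_norm_attaining_def)

lemma bounded_clinear_S: "bounded_clinear S"
  using adj by (simp add: is_cadjoint_on_def bounded_clinear_on_UNIV)

sublocale T: bounded_linear T
  using bounded_clinear_T by (simp add: bounded_clinear_def)

sublocale S: bounded_linear S
  using bounded_clinear_S by (simp add: bounded_clinear_def)

lemma T_scaleC: "T (c *\<^sub>C x) = c *\<^sub>C T x"
  using bounded_clinear_T by (simp add: bounded_clinear_def)

lemma S_scaleC: "S (c *\<^sub>C x) = c *\<^sub>C S x"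
  using bounded_clinear_S by (simp add: bounded_clinear_def)

lemma cinner_T_left: "cinner (T x) y = cinner x (S y)"
  using adj by (simp add: is_cadjoint_on_def)

lemma cinner_S_left: "cinner (S x) y = cinner x (T y)"
  using arg_cong[OF cinner_T_left[of y x], of cnj] by (simp flip: cinner_commute)

text \<open>The adjoint of \<open>comm\<close>. It makes the eigenspaces invariant under
  \<open>S\<close> as well as \<open>T\<close>, whence they reduce \<open>T\<close>.\<close>

lemma S_T_S: "S (T (S y)) = S (S (T y))"
proof -
  have "cinner x (S (T (S y))) = cinner x (S (S (T y)))" for x
    using arg_cong[OF comm[of x], of "\<lambda>z. cinner z y"] by (simp add: cinner_T_left cinner_S_left)
  then have "cinner (S (T (S y)) - S (S (T y))) (S (T (S y)) - S (S (T y))) = 0"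
    by (simp only: cinner_diff_right) simp
  then show ?thesis by simp
qed

lemma T_eig: "x \<in> eig r \<Longrightarrow> T x \<in> eig r"
  by (auto simp: eig_def T.scaleR T.zero simp flip: comm split: if_splits)

lemma S_eig: "x \<in> eig r \<Longrightarrow> S x \<in> eig r"
  by (auto simp: eig_def S_T_S S.scaleR S.zero split: if_splits)

lemma closed_csubspace_eig: "closed_csubspace (eig r)"
  unfolding closed_csubspace_def
proof
  show "csubspace (eig r)"
    by (auto simp: eig_def complex_vector.subspace_def T.zero S.zero T.add S.add T_scaleC S_scaleC
        scaleR_scaleC scaleC_add_right scaleC_scaleC mult.commute)
  show "closed (eig r)"
    unfolding eig_def
    by (auto intro!: closed_Collect_eq continuous_intros S.continuous_on T.continuous_on)
qed

lemma orthogonal_eig: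
  assumes "r \<noteq> s"
  shows "corthogonal (eig r) (eig s)"
  unfolding corthogonal_def
proof (intro ballI)
  fix x y assume xy: "x \<in> eig r" "y \<in> eig s"
  show "cinner x y = 0"
  proof (cases "0 \<le> r \<and> 0 \<le> s")
    case True
    have "cinner (S (T x)) y = cinner x (S (T y))"
      by (simp add: cinner_T_left cinner_S_left)
    then have "of_real (r\<^sup>2) * cinner x y = of_real (s\<^sup>2) * cinner x y"
      using xy True by (simp add: eig_def cinner_scaleR_left cinner_scaleR_right)
    moreover have "r\<^sup>2 \<noteq> s\<^sup>2" using True assms by (simp add: power2_eq_iff_nonneg)
    ultimately show ?thesis by (metis mult_right_cancel of_real_eq_iff)
  qed (use xy in \<open>auto simp: eig_def\<close>)
qed

lemma norm_T_sq: "(norm (T x))\<^sup>2 = Re (cinner (S (T x)) x)"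
  by (simp add: cinner_S_left cinner_self)

lemma norm_T_eig:
  assumes "x \<in> eig r"
  shows "norm (T x) = r * norm x"
proof (cases "0 \<le> r")
  case True
  have "(norm (T x))\<^sup>2 = (r * norm x)\<^sup>2"
    using assms True
    by (simp add: norm_T_sq eig_def cinner_scaleR_left cinner_self power_mult_distrib)
  then show ?thesis using True by (simp add: power2_eq_iff_nonneg)
qed (use assms in \<open>simp add: eig_def T.zero\<close>)

lemma attains:
  assumes "closed_csubspace M" "M \<noteq> {0}"
  obtains x where "x \<in> M" "norm x = 1" "\<And>y. y \<in> M \<Longrightarrow> norm (T y) \<le> norm (T x) * norm y"
proof -
  obtain x where x: "x \<in> M" "norm x = 1" "norm (T x) = onorm_on M T"
    using AN assms by (auto simp: absolutely_norm_attaining_def norm_attaining_on_def)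
  obtain K where K: "\<And>x. norm (T x) \<le> norm x * K" using T.bounded by blast
  have K': "norm (T y) / norm y \<le> \<bar>K\<bar>" for y
  proof (cases "y = 0")
    case False
    have "norm (T y) \<le> \<bar>K\<bar> * norm y" 
      using K[of y] mult_left_mono[OF abs_ge_self[of K] norm_ge_zero[of y]] by (simp add: mult.commute)
    then show ?thesis using False by (simp add: divide_le_eq)
  qed simp
  have "norm (T y) \<le> norm (T x) * norm y" if "y \<in> M" for y
  proof (cases "y = 0")
    case False
    have "norm (T y) / norm y \<le> onorm_on M T"
      unfolding onorm_on_def using K' that by (intro cSUP_upper bdd_aboveI2)
    then show ?thesis using False x(3) by (simp add: divide_le_eq)
  qed (simp add: T.zero)
  then show ?thesis using x that by blast
qed

text \<open>A maximiser \<open>x\<close> of \<open>\<parallel>T y\<parallel>\<close> on the unit sphere of a subspace \<open>M\<close> invariant under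
  \<open>T\<^sup>* T\<close> is an eigenvector of \<open>T\<^sup>* T\<close>: the nonnegative form \<open>\<parallel>T x\<parallel>\<^sup>2 \<parallel>y\<parallel>\<^sup>2 - \<parallel>T y\<parallel>\<^sup>2\<close> on \<open>M\<close>
  vanishes at \<open>y = x\<close>.\<close>

lemma maximiser_is_eigenvector:
  assumes M: "closed_csubspace M" and inv: "\<And>x. x \<in> M \<Longrightarrow> S (T x) \<in> M"
    and x: "x \<in> M" "norm x = 1" "\<And>y. y \<in> M \<Longrightarrow> norm (T y) \<le> norm (T x) * norm y"
  shows "x \<in> eig (norm (T x))"
proof -
  define r where "r = norm (T x)"
  define z where "z = r\<^sup>2 *\<^sub>R x - S (T x)"
  have zM: "z \<in> M"
    unfolding z_def using x(1) by (intro closed_csubspaceD[OF M] inv)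
  have sq: "r\<^sup>2 * inner y y - inner (S (T y)) y \<ge> 0" if "y \<in> M" for y
    using power_mono[OF x(3)[OF that] norm_ge_zero, of 2]
    by (simp add: r_def power_mult_distrib norm_T_sq Re_cinner flip: power2_norm_eq_inner)
  have sym: "inner (S (T y)) w = inner y (S (T w))" for y w
    by (simp flip: Re_cinner add: cinner_T_left cinner_S_left)
  have xx: "r\<^sup>2 * inner x x - inner (S (T x)) x = 0"
    using x(2) norm_T_sq[of x] by (simp add: r_def Re_cinner flip: power2_norm_eq_inner)
  have zx: "inner z z = r\<^sup>2 * inner x z - inner (S (T x)) z"
    by (simp add: z_def inner_diff_left)
  define q where "q = r\<^sup>2 * inner z z - inner (S (T z)) z"
  \<comment> \<open>Expanding the form at \<open>x + t *\<^sub>R z\<close>, the constant term is 0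
    and the linear one is the squared norm of the defect \<open>z\<close> in the eigenvalue
    equation; hence \<open>z = 0\<close>.\<close>
  have "0 \<le> 2 * t * inner z z + t\<^sup>2 * q" for t
  proof -
    have "x + t *\<^sub>R z \<in> M" using x(1) zM by (intro closed_csubspaceD[OF M])
    from sq[OF this] have "0 \<le> r\<^sup>2 * inner (x + t *\<^sub>R z) (x + t *\<^sub>R z)
        - inner (S (T (x + t *\<^sub>R z))) (x + t *\<^sub>R z)" .
    also have "inner (x + t *\<^sub>R z) (x + t *\<^sub>R z) = inner x x + 2 * t * inner x z + t\<^sup>2 * inner z z"
      by (simp add: inner_add inner_commute[of z x] power2_eq_square algebra_simps)
    also have "inner (S (T (x + t *\<^sub>R z))) (x + t *\<^sub>R z)
        = inner (S (T x)) x + 2 * t * inner (S (T x)) z + t\<^sup>2 * inner (S (T z)) z"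
      using sym[of z x]
      by (simp add: T.add S.add T.scaleR S.scaleR inner_add inner_commute[of z x]
          inner_commute[of z "S (T x)"] power2_eq_square algebra_simps)
    also have "r\<^sup>2 * (inner x x + 2 * t * inner x z + t\<^sup>2 * inner z z)
          - (inner (S (T x)) x + 2 * t * inner (S (T x)) z + t\<^sup>2 * inner (S (T z)) z)
        = (r\<^sup>2 * inner x x - inner (S (T x)) x)
        + 2 * t * (r\<^sup>2 * inner x z - inner (S (T x)) z) + t\<^sup>2 * q"
      unfolding q_def by (simp only: ring_distribs mult_ac)
    finally show ?thesis unfolding xx zx by simp
  qed
  from quadratic_nonneg_imp_zero[OF this] have "S (T x) = r\<^sup>2 *\<^sub>R x" by (simp add: z_def)
  then show ?thesis by (simp add: eig_def r_def)
qed

lemma total_eig: "ccomplement (\<Union>r. eig r) \<subseteq> {0}"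
proof (rule ccontr)
  let ?M = "ccomplement (\<Union>r. eig r)"
  assume "\<not> ?M \<subseteq> {0}"
  then have "?M \<noteq> {0}" by blast
  with closed_csubspace_ccomplement obtain x where x: "x \<in> ?M" "norm x = 1"
    "\<And>y. y \<in> ?M \<Longrightarrow> norm (T y) \<le> norm (T x) * norm y"
    using attains by metis
  have "S (T y) \<in> ?M" if "y \<in> ?M" for y
  proof (rule ccomplementI)
    fix z assume "z \<in> (\<Union>r. eig r)"
    then have "S (T z) \<in> (\<Union>r. eig r)" using T_eig S_eig by blast
    with that have "cinner y (S (T z)) = 0" by (rule ccomplementD)
    then show "cinner (S (T y)) z = 0" by (simp only: cinner_S_left cinner_T_left)
  qed
  then have "x \<in> eig (norm (T x))"
    by (intro maximiser_is_eigenvector[OF closed_csubspace_ccomplement _ x])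
  with x(1) have "cinner x x = 0" by (auto simp: ccomplement_def)
  with x(2) show False by simp
qed

sublocale total_orthogonal_family eig
  by unfold_locales (rule closed_csubspace_eig orthogonal_eig total_eig | assumption)+

lemma eig_nonneg: "eig r \<noteq> {0} \<Longrightarrow> 0 \<le> r"
  by (auto simp: eig_def split: if_splits)

lemma component_neg: "r < 0 \<Longrightarrow> component r x = 0"
  using component_in[of r x] by (simp add: eig_def)

lemma eig_bounded:
  obtains K where "0 \<le> K" "\<And>r. eig r \<noteq> {0} \<Longrightarrow> r \<le> K" "\<And>x. norm (T x) \<le> K * norm x"
proof -
  obtain K where K: "0 \<le> K" "\<And>x. norm (T x) \<le> norm x * K" using T.nonneg_bounded by blast
  have "r \<le> K" if nz: "eig r \<noteq> {0}" for r
  proof -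
    obtain x where x: "x \<in> eig r" "x \<noteq> 0"
      using nz closed_csubspaceD(1)[OF closed_csubspace_eig] by blast
    then show ?thesis using K(2)[of x] norm_T_eig[OF x(1)] by (simp add: mult.commute)
  qed
  then show ?thesis using K that by (metis mult.commute)
qed

text \<open>Quasinormality keeps \<open>T\<close> inside every eigenspace, so the images of the
  components of \<open>x\<close> stay orthogonal. The estimates that follow compare \<open>r\<close>
  with a bound term by term.\<close>

lemma norm_T_has_sum: "((\<lambda>r. r\<^sup>2 * (norm (component r x))\<^sup>2) has_sum (norm (T x))\<^sup>2) UNIV"
proof -
  have "((\<lambda>r. (norm (T (component r x)))\<^sup>2) has_sum (norm (T x))\<^sup>2) UNIV"
    using cinner_E[OF _ T_eig[OF component_in] T_eig[OF component_in]]
    by (intro has_sum_norm_sq_orthogonal has_sum_bounded_linear[OF T.bounded_linear_axioms]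
        component_has_sum) auto
  then show ?thesis by (simp add: norm_T_eig[OF component_in] power_mult_distrib)
qed

lemma norm_T_spec_le:
  assumes "x \<in> spec R" "\<And>r. r \<in> R \<Longrightarrow> r \<le> t" "0 \<le> t"
  shows "norm (T x) \<le> t * norm x"
proof (rule power2_le_imp_le)
  have "r\<^sup>2 * (norm (component r x))\<^sup>2 \<le> t\<^sup>2 * (norm (component r x))\<^sup>2" for r
  proof (cases "r \<in> R \<and> 0 \<le> r")
    case True
    then show ?thesis using assms(2) by (intro mult_right_mono power_mono) auto
  next
    case False
    then have "component r x = 0" using assms(1) component_neg[of r x] by (auto simp: spec_iff)
    then show ?thesis by simp
  qed
  then have "(norm (T x))\<^sup>2 \<le> t\<^sup>2 * (norm x)\<^sup>2"
    by (rule has_sum_mono[OF norm_T_has_sum has_sum_cmult_right[OF norm_component_has_sum]])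
  then show "(norm (T x))\<^sup>2 \<le> (t * norm x)\<^sup>2" by (simp add: power_mult_distrib)
qed (use assms(3) in simp)

lemma norm_T_spec_ge:
  assumes "x \<in> spec R" "\<And>r. r \<in> R \<Longrightarrow> t \<le> r" "0 \<le> t"
  shows "t * norm x \<le> norm (T x)"
proof (rule power2_le_imp_le)
  have "t\<^sup>2 * (norm (component r x))\<^sup>2 \<le> r\<^sup>2 * (norm (component r x))\<^sup>2" for r
  proof (cases "r \<in> R")
    case True
    then show ?thesis using assms(2,3) by (intro mult_right_mono power_mono) auto
  next
    case False
    then show ?thesis using assms(1) by (simp add: spec_iff)
  qed
  then have "t\<^sup>2 * (norm x)\<^sup>2 \<le> (norm (T x))\<^sup>2"
    by (rule has_sum_mono[OF has_sum_cmult_right[OF norm_component_has_sum] norm_T_has_sum])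
  then show "(t * norm x)\<^sup>2 \<le> (norm (T x))\<^sup>2" by (simp add: power_mult_distrib)
qed simp

text \<open>Strictness survives the summation because \<open>x\<close> has a nonzero component, and
  its index is strictly below \<open>t\<close>.\<close>

lemma norm_T_spec_less:
  assumes x: "x \<in> spec {..<t}" "x \<noteq> 0" and t: "0 \<le> t"
  shows "norm (T x) < t * norm x"
proof (rule power2_less_imp_less)
  have le: "r\<^sup>2 * (norm (component r x))\<^sup>2 \<le> t\<^sup>2 * (norm (component r x))\<^sup>2" for r
  proof (cases "r < t \<and> 0 \<le> r")
    case True
    then show ?thesis by (intro mult_right_mono power_mono) auto
  next
    case False
    then have "component r x = 0" using x component_neg[of r x] by (auto simp: spec_iff not_less)
    then show ?thesis by simp
  qed
  obtain r where r: "component r x \<noteq> 0"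
    using x(2) component_ext[of x 0] spec_empty spec_iff[of 0 "{}"] by auto
  have "r < t" using x(1) r by (rule_tac ccontr) (simp add: spec_iff)
  moreover have "0 \<le> r" using component_neg[of r x] r by (rule_tac ccontr) simp
  ultimately have "r\<^sup>2 * (norm (component r x))\<^sup>2 < t\<^sup>2 * (norm (component r x))\<^sup>2"
    using r by (intro mult_strict_right_mono power_strict_mono) auto
  then have "(norm (T x))\<^sup>2 < t\<^sup>2 * (norm x)\<^sup>2"
    by (intro has_sum_strict_mono[OF norm_T_has_sum has_sum_cmult_right[OF norm_component_has_sum] le, of r]) auto
  then show "(norm (T x))\<^sup>2 < (t * norm x)\<^sup>2" by (simp add: power_mult_distrib)
qed (use t in simp)

end

section \<open>The accumulation point of the eigenvalues\<close>

context an_quasinormal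
begin

text \<open>For a unit maximiser \<open>x\<close> on the closed span, the square of
  \<open>norm (T x)\<close> is an average of the squares of \<open>norm (T (g n))\<close>, with the
  squared moduli of \<open>cinner x (g n)\<close> as weights. All averaged values lie strictly below
  it, so every weight would vanish.\<close>

lemma no_increasing_sequence:
  fixes g :: "nat \<Rightarrow> 'a"
  assumes unit: "\<And>n. norm (g n) = 1"
    and orth: "\<And>j n. j < n \<Longrightarrow> cinner (g n) (g j) = 0"
    and Torth: "\<And>j n. j < n \<Longrightarrow> cinner (T (g n)) (T (g j)) = 0"
    and incr: "\<And>j n. j < n \<Longrightarrow> norm (T (g j)) < norm (T (g n))"
  shows False
proof -
  define L where "L n = cspan {g n}" for n
  define M where "M = ccomplement (ccomplement (\<Union>n. L n))"
  have orth': "cinner (g i) (g j) = 0" "cinner (T (g i)) (T (g j)) = 0" if "i \<noteq> j" for i j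
    using that orth Torth cinner_eq_zero_sym by (metis linorder_neqE_nat)+
  have gM: "g n \<in> M" for n
    unfolding M_def L_def
    by (rule ccomplementI)
       (auto simp: ccomplement_def cinner_eq_zero_sym[of "g n"] intro: complex_vector.span_base)
  have M: "closed_csubspace M" unfolding M_def by (rule closed_csubspace_ccomplement)
  moreover have "M \<noteq> {0}" using gM[of 0] unit[of 0] by auto
  ultimately obtain x where x: "x \<in> M" "norm x = 1" "\<And>y. y \<in> M \<Longrightarrow> norm (T y) \<le> norm (T x) * norm y"
    using attains by metis
  define f where "f n = cinner x (g n) *\<^sub>C g n" for n
  have f: "(f has_sum x) UNIV"
  proof (rule orthogonal_components_has_sum)
    show "corthogonal (L i) (L j)" if "i \<noteq> j" for i j
      using orth'(1)[OF that]
      by (auto simp: L_def corthogonal_def complex_vector.span_singleton cinner_scaleC_left cinner_scaleC_right)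
    show "f i \<in> L i" for i
      by (simp add: f_def L_def complex_vector.span_base complex_vector.span_scale)
    show "x - f i \<in> ccomplement (L i)" for i
      by (auto simp: L_def f_def ccomplement_def complex_vector.span_singleton cinner_diff_left
          cinner_scaleC_left cinner_scaleC_right cinner_self unit)
  qed (use x(1) in \<open>simp add: M_def\<close>)
  have "((\<lambda>n. (norm (f n))\<^sup>2) has_sum (norm x)\<^sup>2) UNIV"
    using orth'(1)
    by (intro has_sum_norm_sq_orthogonal[OF f]) (auto simp: f_def cinner_scaleC_left cinner_scaleC_right)
  from has_sum_cmult_right[OF this, of "(norm (T x))\<^sup>2"]
  have 1: "((\<lambda>n. (norm (T x))\<^sup>2 * (norm (f n))\<^sup>2) has_sum (norm (T x))\<^sup>2) UNIV"
    by (simp add: x(2))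
  have 2: "((\<lambda>n. (norm (T (f n)))\<^sup>2) has_sum (norm (T x))\<^sup>2) UNIV"
    using orth'(2)
    by (intro has_sum_norm_sq_orthogonal has_sum_bounded_linear[OF T.bounded_linear_axioms f])
       (auto simp: f_def T_scaleC cinner_scaleC_left cinner_scaleC_right)
  \<comment> \<open>The successor \<open>g (Suc n)\<close> beats \<open>g n\<close> and is itself
    dominated by the maximiser.\<close>
  have less: "norm (T (g n)) < norm (T x)" for n
    using incr[of n "Suc n"] x(3)[OF gM, of "Suc n"] unit[of "Suc n"] by simp
  have le: "(norm (T (f n)))\<^sup>2 \<le> (norm (T x))\<^sup>2 * (norm (f n))\<^sup>2" for n
    using power_mono[OF less_imp_le[OF less[of n]], of 2] unit[of n]
    by (simp add: f_def T_scaleC power_mult_distrib mult.commute[of "(norm (T x))\<^sup>2"] mult_left_mono)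
  have "cinner x (g n) = 0" for n
  proof (rule ccontr)
    assume "cinner x (g n) \<noteq> 0"
    then have "(norm (T (f n)))\<^sup>2 < (norm (T x))\<^sup>2 * (norm (f n))\<^sup>2"
      using power_strict_mono[OF less[of n], of 2] unit[of n]
      by (simp add: f_def T_scaleC power_mult_distrib mult.commute[of "(norm (T x))\<^sup>2"]
          mult_strict_left_mono)
    from has_sum_strict_mono[OF 2 1 le _ this] show False by simp
  qed
  then have "f = (\<lambda>n. 0)" by (simp add: f_def fun_eq_iff)
  with f have "((\<lambda>n :: nat. 0 :: 'a) has_sum x) UNIV" by simp
  from has_sum_unique[OF this has_sum_0_simp] x(2) show False by simp
qed

text \<open>Dependent choice turns a one-step extension property into the forbidden sequence. The
  invariant \<open>Q\<close> leaves room for the next step; in both applications it is a strict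
  upper bound on \<open>norm (T v)\<close>.\<close>

lemma no_increasing_extension:
  assumes ext: "\<And>W. finite W \<Longrightarrow> (\<And>w. w \<in> W \<Longrightarrow> Q w) \<Longrightarrow>
    \<exists>v. Q v \<and> norm v = 1 \<and>
      (\<forall>w\<in>W. cinner v w = 0 \<and> cinner (T v) (T w) = 0 \<and> norm (T w) < norm (T v))"
  shows False
proof -
  define P :: "(nat \<Rightarrow> 'a) \<Rightarrow> nat \<Rightarrow> 'a \<Rightarrow> bool" where
    "P g n v \<longleftrightarrow> Q v \<and> norm v = 1 \<and>
      (\<forall>j<n. cinner v (g j) = 0 \<and> cinner (T v) (T (g j)) = 0 \<and> norm (T (g j)) < norm (T v))"
    for g n v
  have "\<exists>g. \<forall>n. P g n (g n)"
  proof (rule dependent_wellorder_choice)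
    fix n :: nat and g assume "\<And>y. y < n \<Longrightarrow> P g y (g y)"
    then have "Q w" if "w \<in> g ` {..<n}" for w using that by (auto simp: P_def)
    with ext[of "g ` {..<n}"] show "\<exists>r. P g n r" by (auto simp: P_def)
  qed (auto simp: P_def)
  then obtain g where "\<And>n. P g n (g n)" by blast
  then show False by (intro no_increasing_sequence[of g]) (auto simp: P_def)
qed

text \<open>If both spectral subspaces were infinite dimensional, unit vectors \<open>v\<close> with any prescribed
  value \<open>\<parallel>T v\<parallel>\<close> between \<open>s\<close> and \<open>t\<close> could be found orthogonal to any finite set, as suitable
  combinations of a vector from each of them.\<close>

lemma cfinite_dim_spec_dichotomy:
  assumes st: "0 \<le> s" "s < t" and inf: "\<not> cfinite_dim (spec {..<s})"
  shows "cfinite_dim (spec {t..})"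
proof (rule ccontr)
  assume inf': "\<not> cfinite_dim (spec {t..})"
  have sub: "csubspace (spec R)" for R using closed_csubspace_spec by (simp add: closed_csubspace_def)
  show False
  proof (rule no_increasing_extension[of "\<lambda>v. norm (T v) < t"])
    fix W assume W: "finite W" "\<And>w. w \<in> W \<Longrightarrow> norm (T w) < t"
    define c where "c = Max (insert s ((\<lambda>w. norm (T w)) ` W))"
    have c: "s \<le> c" "\<And>w. w \<in> W \<Longrightarrow> norm (T w) \<le> c" "c < t"
      unfolding c_def using W st by (auto simp: Max_ge)
    define d where "d = (c + t) / 2"
    have d: "c < d" "d < t" "s < d" "0 < d" using c st by (auto simp: d_def)
    \<comment> \<open>Orthogonality of \<open>T v\<close> to \<open>T w\<close> is orthogonality of
      \<open>v\<close> to \<open>S (T w)\<close>, so these vectors join the constraints.\<close>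
    define W' where "W' = W \<union> (\<lambda>w. S (T w)) ` W"
    have W': "finite W'" using W by (simp add: W'_def)
    obtain e where e: "e \<in> spec {..<s}" "norm e = 1" "\<And>w. w \<in> W' \<Longrightarrow> cinner e w = 0"
      using exists_unit_orthogonal[OF sub inf W'] by metis
    \<comment> \<open>Constraining \<open>f\<close> by \<open>e\<close> and \<open>S (T e)\<close>
      makes \<open>e\<close> and \<open>f\<close>, and also their images, orthogonal; Pythagoras
      then gives the norms of the combination and of its image.\<close>
    have "finite (W' \<union> {e, S (T e)})" using W' by simp
    from exists_unit_orthogonal[OF sub inf' this]
    obtain f where f: "f \<in> spec {t..}" "norm f = 1" "\<And>w. w \<in> W' \<union> {e, S (T e)} \<Longrightarrow> cinner f w = 0"
      by metis
    define p q where "p = (norm (T e))\<^sup>2" and "q = (norm (T f))\<^sup>2"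
    have "norm (T e) \<le> s" using norm_T_spec_le[OF e(1), of s] e(2) st by auto
    then have p: "p < d\<^sup>2" unfolding p_def using d by (intro power_strict_mono) auto
    have "t \<le> norm (T f)" using norm_T_spec_ge[OF f(1), of t] f(2) st by auto
    then have q: "d\<^sup>2 < q" unfolding q_def using d by (intro power_strict_mono) auto
    \<comment> \<open>The weight that solves \<open>u * p + (1 - u) * q = d\<^sup>2\<close>; it lies
      in the unit interval because \<open>d\<^sup>2\<close> is between \<open>p\<close> and
      \<open>q\<close>.\<close>
    define u where "u = (q - d\<^sup>2) / (q - p)"
    have u: "0 \<le> u" "0 \<le> 1 - u" using p q by (auto simp: u_def)
    have "u * (q - p) = q - d\<^sup>2" using p q by (simp add: u_def)
    then have u': "u * p + (1 - u) * q = d\<^sup>2" by (simp add: algebra_simps)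
    define v where "v = sqrt u *\<^sub>R e + sqrt (1 - u) *\<^sub>R f"
    have Tv: "T v = sqrt u *\<^sub>R T e + sqrt (1 - u) *\<^sub>R T f" by (simp add: v_def T.add T.scaleR)
    have "cinner e f = 0" using f(3)[of e] by (simp add: cinner_eq_zero_sym)
    then have "cinner (sqrt u *\<^sub>R e) (sqrt (1 - u) *\<^sub>R f) = 0"
      by (simp add: cinner_scaleR_left cinner_scaleR_right)
    from norm_add_sq_orthogonal[OF this] have "(norm v)\<^sup>2 = 1"
      using u by (simp add: v_def power_mult_distrib e(2) f(2))
    then have nv: "norm v = 1" using norm_ge_zero[of v] by (auto simp: power2_eq_1_iff)
    have "cinner (T f) (T e) = 0" using f(3)[of "S (T e)"] by (simp add: cinner_T_left)
    then have "cinner (sqrt u *\<^sub>R T e) (sqrt (1 - u) *\<^sub>R T f) = 0"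
      by (simp add: cinner_scaleR_left cinner_scaleR_right cinner_eq_zero_sym[of "T e"])
    from norm_add_sq_orthogonal[OF this] have "(norm (T v))\<^sup>2 = d\<^sup>2"
      using u u' by (simp add: Tv power_mult_distrib p_def q_def)
    then have nTv: "norm (T v) = d" using d by (simp add: power2_eq_iff_nonneg)
    have v0: "cinner v w = 0" if "w \<in> W'" for w
      using e(3) f(3) that by (simp add: v_def cinner_add_left cinner_scaleR_left)
    have "cinner v w = 0 \<and> cinner (T v) (T w) = 0 \<and> norm (T w) < norm (T v)" if "w \<in> W" for w
    proof (intro conjI)
      show "norm (T w) < norm (T v)" using c(2)[OF that] d(1) nTv by simp
    qed (auto simp: cinner_T_left W'_def that intro!: v0)
    then show "\<exists>v. norm (T v) < t \<and> norm v = 1 \<and>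
        (\<forall>w\<in>W. cinner v w = 0 \<and> cinner (T v) (T w) = 0 \<and> norm (T w) < norm (T v))"
      using nv nTv d(2) by blast
  qed
qed

lemma spec_nonpos: "t \<le> 0 \<Longrightarrow> spec {..<t} = {0}"
  using spec_cong[of "{..<t}" "{}"] eig_nonneg by (force simp: spec_empty)

text \<open>A unit vector \<open>v\<close> of \<open>spec {..<a}\<close> orthogonal to the
  finite-dimensional \<open>spec {..<t}\<close> satisfies \<open>t \<le> norm (T v)\<close> and
  \<open>norm (T v) < a\<close>. With \<open>t\<close> above all earlier values, this continues an
  increasing sequence.\<close>

lemma cfinite_dim_spec_limit:
  assumes fin: "\<And>t. t < a \<Longrightarrow> cfinite_dim (spec {..<t})"
  shows "cfinite_dim (spec {..<a})"
proof (rule ccontr)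
  assume inf: "\<not> cfinite_dim (spec {..<a})"
  then have a: "0 < a" using spec_nonpos[of a] cfinite_dim_zero by (metis not_less)
  have sub: "csubspace (spec R)" for R using closed_csubspace_spec by (simp add: closed_csubspace_def)
  show False
  proof (rule no_increasing_extension[of "\<lambda>v. norm (T v) < a"])
    fix W assume W: "finite W" "\<And>w. w \<in> W \<Longrightarrow> norm (T w) < a"
    define c where "c = Max (insert 0 ((\<lambda>w. norm (T w)) ` W))"
    have c: "0 \<le> c" "\<And>w. w \<in> W \<Longrightarrow> norm (T w) \<le> c" "c < a"
      unfolding c_def using W a by (auto simp: Max_ge)
    define t where "t = (c + a) / 2"
    have t: "c < t" "t < a" "0 \<le> t" using c by (auto simp: t_def)
    obtain B where B: "finite B" "spec {..<t} \<subseteq> cspan B" using fin[OF t(2)] by (auto simp: cfinite_dim_def)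
    \<comment> \<open>A spanning set \<open>B\<close> among the constraints makes \<open>v\<close>
      orthogonal to all of \<open>spec {..<t}\<close>, that is, puts it into
      \<open>spec {t..}\<close>.\<close>
    define W' where "W' = W \<union> (\<lambda>w. S (T w)) ` W \<union> B"
    have W': "finite W'" using W B by (simp add: W'_def)
    obtain v where v: "v \<in> spec {..<a}" "norm v = 1" "\<And>w. w \<in> W' \<Longrightarrow> cinner v w = 0"
      using exists_unit_orthogonal[OF sub inf W'] by metis
    have "cspan B \<subseteq> ccomplement {v}"
      using v(3) by (intro complex_vector.span_minimal csubspace_ccomplement)
        (auto simp: W'_def ccomplement_def cinner_eq_zero_sym[of _ v])
    then have "component r v = 0" if "r < t" for r
      using B(2) E_subset_spec[of r "{..<t}"] that
      by (auto simp: component_eq_zero_iff ccomplement_def cinner_eq_zero_sym[of _ v])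
    then have "v \<in> spec {t..}" by (simp add: spec_iff)
    then have "t \<le> norm (T v)" using norm_T_spec_ge[of v "{t..}" t] v(2) t(3) by auto
    moreover have "norm (T v) < a" using norm_T_spec_less[OF v(1)] v(2) a by fastforce
    moreover have "cinner v w = 0 \<and> cinner (T v) (T w) = 0" if "w \<in> W" for w
      using that by (auto simp: cinner_T_left W'_def intro!: v(3))
    moreover have "norm (T w) < norm (T v)" if "w \<in> W" for w
      using c(2)[OF that] t(1) \<open>t \<le> norm (T v)\<close> by linarith
    ultimately show "\<exists>v. norm (T v) < a \<and> norm v = 1 \<and>
        (\<forall>w\<in>W. cinner v w = 0 \<and> cinner (T v) (T w) = 0 \<and> norm (T w) < norm (T v))"
      using v(2) by blast
  qed
qed

lemma spec_UNIV: "spec UNIV = UNIV"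
  by (simp add: spec_def ccomplement_def)

text \<open>Eigenvalues are bounded, so a large threshold yields the whole space; its infinite
  dimension bounds the set \<open>F\<close> whose supremum is \<open>a\<close>.\<close>

lemma essential_point_exists:
  assumes "\<not> cfinite_dim (UNIV :: 'a set)"
  obtains a where "0 \<le> a" "cfinite_dim (spec {..<a})" "\<And>t. a < t \<Longrightarrow> cfinite_dim (spec {t..})"
proof -
  define F where "F = {t. cfinite_dim (spec {..<t})}"
  have down: "t \<in> F" if "s \<in> F" "t \<le> s" for s t
    using that cfinite_dim_subset[OF _ spec_mono, of "{..<s}" "{..<t}"] by (auto simp: F_def)
  have 0: "0 \<in> F" using spec_nonpos[of 0] cfinite_dim_zero by (simp add: F_def)
  obtain K where K: "\<And>r. eig r \<noteq> {0} \<Longrightarrow> r \<le> K" using eig_bounded by metis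
  have "spec {..<K + 1} = spec UNIV"
  proof (rule spec_cong)
    show "r \<in> {..<K + 1} \<longleftrightarrow> r \<in> UNIV" if "eig r \<noteq> {0}" for r using K[OF that] by simp
  qed
  then have "K + 1 \<notin> F" using assms spec_UNIV by (simp add: F_def)
  have bdd: "bdd_above F"
  proof (rule bdd_aboveI)
    show "t \<le> K + 1" if "t \<in> F" for t
      using down[OF that, of "K + 1"] \<open>K + 1 \<notin> F\<close> by (cases "t \<le> K + 1") auto
  qed
  define a where "a = Sup F"
  have "cfinite_dim (spec {..<t})" if "t < a" for t
  proof -
    have "F \<noteq> {}" using 0 by blast
    from less_cSupD[OF this that[unfolded a_def]] obtain s where "s \<in> F" "t < s" by blast
    then show ?thesis using down[of s t] by (simp add: F_def)
  qed
  then have fin: "cfinite_dim (spec {..<a})" by (rule cfinite_dim_spec_limit)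
  have a: "0 \<le> a" unfolding a_def by (rule cSup_upper[OF 0 bdd])
  \<comment> \<open>The midpoint of \<open>a\<close> and \<open>t\<close> exceeds the supremum, so
    the part below it is infinite dimensional and the dichotomy applies.\<close>
  moreover have "cfinite_dim (spec {t..})" if "a < t" for t
  proof (rule cfinite_dim_spec_dichotomy)
    show "0 \<le> (a + t) / 2" "(a + t) / 2 < t" using a that by auto
    have "(a + t) / 2 \<notin> F" using that cSup_upper[OF _ bdd, of "(a + t) / 2"] by (auto simp: a_def)
    then show "\<not> cfinite_dim (spec {..<(a + t) / 2})" by (simp add: F_def)
  qed
  ultimately show ?thesis using that fin by blast
qed

lemma finite_eigenvalues:
  assumes "cfinite_dim (spec R)"
  shows "finite {r \<in> R. eig r \<noteq> {0}}"
proof (rule ccontr)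
  define D where "D = {r \<in> R. eig r \<noteq> {0}}"
  assume "infinite {r \<in> R. eig r \<noteq> {0}}"
  then have inf: "infinite D" by (simp add: D_def)
  obtain B where B: "finite B" "spec R \<subseteq> cspan B" using assms by (auto simp: cfinite_dim_def)
  have "\<exists>v. v \<in> eig r \<and> v \<noteq> 0" if "r \<in> D" for r
  proof (rule ccontr)
    assume "\<nexists>v. v \<in> eig r \<and> v \<noteq> 0"
    then have "eig r = {0}" using closed_csubspaceD(1)[OF closed_csubspace_eig[of r]] by auto
    then show False using that by (simp add: D_def)
  qed
  then obtain e where e: "\<And>r. r \<in> D \<Longrightarrow> e r \<in> eig r" "\<And>r. r \<in> D \<Longrightarrow> e r \<noteq> 0" by metis
  have orth: "cinner (e r) (e s) = 0" if "r \<in> D" "s \<in> D" "r \<noteq> s" for r s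
    by (rule cinner_E[OF that(3) e(1)[OF that(1)] e(1)[OF that(2)]])
  have inj: "inj_on e D"
  proof (rule inj_onI, rule ccontr)
    fix r s assume rs: "r \<in> D" "s \<in> D" "e r = e s" "r \<noteq> s"
    then show False using orth[of r s] e(2)[of s] by simp
  qed
  have "e r \<notin> cspan (e ` D - {e r})" if r: "r \<in> D" for r
  proof
    assume *: "e r \<in> cspan (e ` D - {e r})"
    have "cspan (e ` D - {e r}) \<subseteq> ccomplement {e r}"
    proof (intro complex_vector.span_minimal csubspace_ccomplement subsetI)
      fix v assume "v \<in> e ` D - {e r}"
      then obtain s where "s \<in> D" "v = e s" "s \<noteq> r" by blast
      then show "v \<in> ccomplement {e r}" using orth r by (simp add: ccomplement_def)
    qed
    with * have "cinner (e r) (e r) = 0" by (auto simp: ccomplement_def)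
    then show False using e(2)[OF r] by simp
  qed
  then have "\<not> complex_vector.dependent (e ` D)" by (auto simp: complex_vector.dependent_def)
  moreover have "e ` D \<subseteq> cspan B" using e(1) E_subset_spec B(2) by (fastforce simp: D_def)
  ultimately have "finite (e ` D)" using complex_vector.independent_span_bound[OF B(1)] by blast
  then show False using inf inj finite_imageD by blast
qed

end

section \<open>The modulus and its spectra\<close>

context an_quasinormal
begin

lemma bounded_symbol_of_real: "bounded_symbol complex_of_real"
proof -
  obtain K where K: "\<And>r. eig r \<noteq> {0} \<Longrightarrow> r \<le> K" using eig_bounded by metis
  have "cmod (of_real r) \<le> K" if "eig r \<noteq> {0}" for r using K[OF that] eig_nonneg[OF that] by simp
  then show ?thesis unfolding bounded_symbol_def by blast
qed

lemma diag_of_real_square: "diag complex_of_real \<circ> diag complex_of_real = S \<circ> T"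
proof
  fix x
  have "S (T x) = diag (\<lambda>r. complex_of_real r * complex_of_real r) x"
  proof (rule diag_eqI[where A = "\<lambda>x. S (T x)"])
    show "bounded_linear (\<lambda>x. S (T x))"
      by (rule bounded_linear_compose[OF S.bounded_linear_axioms T.bounded_linear_axioms])
    show "S (T y) = (complex_of_real r * complex_of_real r) *\<^sub>C y" if "y \<in> eig r" for r y
      using that by (auto simp: eig_def scaleR_scaleC power2_eq_square T.zero S.zero split: if_splits)
  qed (intro bounded_symbol_mult bounded_symbol_of_real)
  then show "(diag complex_of_real \<circ> diag complex_of_real) x = (S \<circ> T) x"
    by (simp add: diag_diag bounded_symbol_of_real)
qed

lemma positive_diag_of_real: "positive_op (diag complex_of_real)"
  unfolding positive_op_def
proof (intro conjI allI bounded_clinear_diag bounded_symbol_of_real)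
  fix x
  have "((\<lambda>r. complex_of_real (r * (norm (component r x))\<^sup>2)) has_sum cinner (diag complex_of_real x) x) UNIV"
    using cinner_diag_has_sum[OF bounded_symbol_of_real, of x x] by (simp add: cinner_self)
  note * = has_sum_bounded_linear[OF bounded_linear_Re this] has_sum_bounded_linear[OF bounded_linear_Im this]
  have "((\<lambda>r :: real. 0 :: real) has_sum Im (cinner (diag complex_of_real x) x)) UNIV"
    using *(2) by simp
  from has_sum_unique[OF this has_sum_0_simp] show "cinner (diag complex_of_real x) x \<in> \<real>"
    by (simp add: complex_is_Real_iff)
  have "0 \<le> r * (norm (component r x))\<^sup>2" for r
    using component_neg[of r x] by (cases "r < 0") auto
  then show "0 \<le> Re (cinner (diag complex_of_real x) x)"
    using has_sum_nonneg[OF *(1)] by (simp del: of_real_mult)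
qed

text \<open>On the line through \<open>y\<close> in direction \<open>Q y\<close> the image under
  \<open>Q\<close> is constantly \<open>Q y\<close>. The form is therefore affine with slope the
  squared norm of \<open>Q y\<close>, and becomes negative unless \<open>Q y = 0\<close>; the chosen
  \<open>t\<close> gives it the value -1.\<close>

lemma positive_op_square_kernel:
  assumes Q: "positive_op Q" and 0: "Q (Q y) = 0"
  shows "Q y = (0 :: 'a)"
proof (rule ccontr)
  interpret Q: bounded_linear Q using Q by (simp add: positive_op_def bounded_clinear_def)
  define z where "z = Q y"
  assume "Q y \<noteq> 0"
  then have pos: "0 < inner z z" by (simp add: z_def)
  define t where "t = - (inner z y + 1) / inner z z"
  have "0 \<le> Re (cinner (Q (y + t *\<^sub>R z)) (y + t *\<^sub>R z))" using Q by (simp add: positive_op_def)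
  also have "Q (y + t *\<^sub>R z) = z" using 0 by (simp add: Q.add Q.scaleR z_def)
  also have "Re (cinner z (y + t *\<^sub>R z)) = inner z y + t * inner z z"
    by (simp add: Re_cinner inner_add_right)
  also have "\<dots> = - 1" using pos by (simp add: t_def)
  finally show False by simp
qed

text \<open>It suffices to compare on eigenvectors. For \<open>0 < r\<close>, the vector
  \<open>z = Q y - r *\<^sub>R y\<close> satisfies \<open>Q z = - (r *\<^sub>R z)\<close>, which
  positivity of \<open>Q\<close> permits only for \<open>z = 0\<close>.\<close>

lemma positive_sqrt_unique:
  assumes Q: "positive_op Q" and QQ: "Q \<circ> Q = S \<circ> T"
  shows "Q = diag complex_of_real"
proof
  fix x
  interpret Q: bounded_linear Q using Q by (simp add: positive_op_def bounded_clinear_def)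
  have QQ: "Q (Q y) = S (T y)" for y using fun_cong[OF QQ, of y] by simp
  show "Q x = diag complex_of_real x"
  proof (rule diag_eqI[OF bounded_symbol_of_real Q.bounded_linear_axioms])
    fix r y assume y: "y \<in> eig r"
    consider "r < 0" | "r = 0" | "0 < r" by linarith
    then show "Q y = complex_of_real r *\<^sub>C y"
    proof cases
      case 1
      then show ?thesis using y by (simp add: eig_def Q.zero)
    next
      case 2
      then have "Q (Q y) = 0" using y by (simp add: QQ eig_def)
      then show ?thesis using positive_op_square_kernel[OF Q] 2 by simp
    next
      case 3
      define z where "z = Q y - r *\<^sub>R y"
      have "Q z = - (r *\<^sub>R z)"
        using y 3 by (simp add: z_def Q.diff Q.scaleR QQ eig_def power2_eq_square scaleR_right_diff_distrib)
      moreover have "0 \<le> Re (cinner (Q z) z)" using Q by (simp add: positive_op_def)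
      ultimately have "r * inner z z \<le> 0" by (simp add: Re_cinner)
      then have "z = 0" using 3 inner_ge_zero[of z] by (simp add: mult_le_0_iff)
      then show ?thesis by (simp add: z_def scaleR_scaleC)
    qed
  qed
qed

lemma abs_op_T: "abs_op T = diag complex_of_real"
  unfolding abs_op_def op_sqrt_def cadjoint_eqI[OF adj]
proof (rule the_equality)
  show "positive_op (diag complex_of_real) \<and> diag complex_of_real \<circ> diag complex_of_real = S \<circ> T"
    using positive_diag_of_real diag_of_real_square by blast
  show "Q = diag complex_of_real" if "positive_op Q \<and> Q \<circ> Q = S \<circ> T" for Q
    using that positive_sqrt_unique by blast
qed

lemma null_space_abs_op_shift:
  "null_space (op_shift (abs_op T) c) = spec {r. complex_of_real r = c}"
  by (simp add: abs_op_T op_shift_diag null_space_diag bounded_symbol_diff_const bounded_symbol_of_real)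

lemma null_space_abs_op_shift_of_real:
  "null_space (op_shift (abs_op T) (complex_of_real r)) = eig r"
  by (simp add: null_space_abs_op_shift spec_singleton)

lemma exists_unit_eig:
  assumes "eig r \<noteq> {0}"
  obtains x where "x \<in> eig r" "norm x = 1"
proof -
  obtain y where y: "y \<in> eig r" "y \<noteq> 0"
    using assms closed_csubspaceD(1)[OF closed_csubspace_eig[of r]] by auto
  have "inverse (norm y) *\<^sub>R y \<in> eig r" by (rule closed_csubspaceD(5)[OF closed_csubspace_eig y(1)])
  then show ?thesis using y(2) by (intro that[of "inverse (norm y) *\<^sub>R y"]) auto
qed

lemma cfinite_dim_spec_Un:
  assumes "cfinite_dim (spec R)" "cfinite_dim (spec R')" "R \<inter> R' = {}"
  shows "cfinite_dim (spec (R \<union> R'))"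
proof -
  obtain B B' where B: "finite B" "spec R \<subseteq> cspan B" "finite B'" "spec R' \<subseteq> cspan B'"
    using assms by (auto simp: cfinite_dim_def)
  have "x \<in> cspan (B \<union> B')" if x: "x \<in> spec (R \<union> R')" for x
  proof -
    obtain y z where "y \<in> spec R" "z \<in> spec R'" "x = y + z"
      by (rule spec_split[OF x assms(3)])
    moreover have "cspan B \<subseteq> cspan (B \<union> B')" "cspan B' \<subseteq> cspan (B \<union> B')"
      by (simp_all add: complex_vector.span_mono)
    ultimately have "y \<in> cspan (B \<union> B')" "z \<in> cspan (B \<union> B')" using B(2,4) by blast+
    then show ?thesis unfolding \<open>x = y + z\<close> by (rule complex_vector.span_add)
  qed
  then show ?thesis unfolding cfinite_dim_def using B(1,3) by (intro exI[of _ "B \<union> B'"]) auto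
qed

text \<open>Take unit eigenvectors \<open>e n\<close> with eigenvalues within \<open>(1/4)^n\<close>
  of \<open>a\<close>. The sum of the \<open>e n\<close> with weights \<open>(1/2)^n\<close> is a
  limit of vectors in the range, but dividing by the gaps shows that a preimage would have
  coefficients of modulus at least \<open>2^n\<close>.\<close>

lemma accumulating_eigenvalues_not_closed_range:
  assumes acc: "\<And>e. 0 < e \<Longrightarrow> \<exists>r. a < r \<and> r < a + e \<and> eig r \<noteq> {0}"
  shows "\<not> closed (range (diag (\<lambda>r. complex_of_real r - of_real a)))"
proof
  let ?g = "\<lambda>r. complex_of_real r - of_real a"
  assume cl: "closed (range (diag ?g))"
  have g: "bounded_symbol ?g" by (intro bounded_symbol_diff_const bounded_symbol_of_real)
  interpret D: bounded_linear "diag ?g"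
    using bounded_clinear_diag[OF g] by (simp add: bounded_clinear_def)
  \<comment> \<open>A strictly decreasing choice keeps the eigenvalues distinct and hence the
    eigenvectors orthogonal.\<close>
  have "\<exists>r :: nat \<Rightarrow> real. \<forall>n. (a < r n \<and> r n < a + (1/4)^n \<and> eig (r n) \<noteq> {0}) \<and> r (Suc n) < r n"
  proof (rule dependent_nat_choice)
    show "\<exists>x. a < x \<and> x < a + (1/4)^0 \<and> eig x \<noteq> {0}" using acc[of 1] by simp
    fix x and n :: nat assume "a < x \<and> x < a + (1/4)^n \<and> eig x \<noteq> {0}"
    then have "0 < min (x - a) ((1/4)^Suc n)" by simp
    from acc[OF this] obtain y where "a < y" "y < a + min (x - a) ((1/4)^Suc n)" "eig y \<noteq> {0}"
      by blast
    moreover from this(2) have "y < a + (1/4)^Suc n" "y < x"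
      by linarith+
    ultimately show "\<exists>y. (a < y \<and> y < a + (1/4)^Suc n \<and> eig y \<noteq> {0}) \<and> y < x" by blast
  qed
  then obtain r where "\<forall>n. (a < r n \<and> r n < a + (1/4)^n \<and> eig (r n) \<noteq> {0}) \<and> r (Suc n) < r n" ..
  then have r: "a < r n" "r n < a + (1/4)^n" "eig (r n) \<noteq> {0}" "r (Suc n) < r n" for n by blast+
  have "strict_mono (\<lambda>n. - r n)" using r(4) by (simp add: strict_mono_Suc_iff)
  then have inj: "r m \<noteq> r n" if "m \<noteq> n" for m n using strict_mono_eq[of "\<lambda>n. - r n" m n] that by simp
  have "\<exists>x. x \<in> eig (r n) \<and> norm x = 1" for n by (rule exists_unit_eig[OF r(3)[of n]]) blast
  then obtain e where e: "\<And>n. e n \<in> eig (r n)" "\<And>n. norm (e n) = 1" by metis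
  define f where "f n = ((1/2)^n :: real) *\<^sub>R e n" for n
  have "summable (\<lambda>n. norm (f n))" by (simp add: f_def e(2))
  then have "summable f" by (rule summable_norm_cancel)
  then obtain y where y: "f sums y" by (auto simp: summable_def)
  have "f n = diag ?g (((1/2)^n / (r n - a)) *\<^sub>R e n)" for n
  proof -
    have "?g (r n) = complex_of_real (r n - a)" by simp
    then have "diag ?g (e n) = (r n - a) *\<^sub>R e n"
      by (simp only: diag_E[OF g e(1)] scaleR_scaleC)
    then show ?thesis using r(1)[of n] by (simp add: D.scaleR f_def)
  qed
  then have "sum f {..<n} = diag ?g (\<Sum>k<n. ((1/2)^k / (r k - a)) *\<^sub>R e k)" for n
    by (simp add: D.sum)
  then have "sum f {..<n} \<in> range (diag ?g)" for n by simp
  from closed_sequentially[OF cl this y[unfolded sums_def]] obtain x where x: "y = diag ?g x"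
    by (rule rangeE)
  have "2^n \<le> norm x" for n
  proof -
    have "(\<lambda>k. cinner (f k) (e n)) sums cinner y (e n)"
      by (rule bounded_linear.sums[OF bounded_linear_cinner_left y])
    moreover have "(\<lambda>k. cinner (f k) (e n)) sums (\<Sum>k\<in>{n}. cinner (f k) (e n))"
    proof (rule sums_finite)
      show "cinner (f k) (e n) = 0" if "k \<notin> {n}" for k
        using cinner_E[OF inj[of k n] e(1) e(1)] that by (simp add: f_def cinner_scaleR_left)
    qed simp
    ultimately have "cinner y (e n) = (\<Sum>k\<in>{n}. cinner (f k) (e n))" by (rule sums_unique2)
    then have "cinner y (e n) = cinner (f n) (e n)" by simp
    then have 1: "cinner y (e n) = of_real ((1/2)^n)"
      by (simp add: f_def cinner_scaleR_left cinner_self e(2))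
    have "cinner y (e n) = cinner (component (r n) y) (e n)" by (simp add: cinner_component[OF e(1)])
    also have "\<dots> = ?g (r n) * cinner x (e n)"
      by (simp add: x component_diag[OF g] cinner_scaleC_left cinner_component[OF e(1)])
    finally have "cmod (complex_of_real ((1/2)^n)) = cmod (?g (r n)) * cmod (cinner x (e n))"
      unfolding 1 by (simp only: norm_mult)
    moreover have "cmod (?g (r n)) = r n - a"
      using r(1)[of n] by (simp flip: of_real_diff)
    moreover have "cmod (cinner x (e n)) \<le> norm x" using norm_cinner_le[of x "e n"] e(2) by simp
    moreover have "r n - a \<le> (1/4)^n" using r(2)[of n] by simp
    ultimately have "(1/2)^n \<le> (1/4)^n * norm x"
      using r(1)[of n] mult_mono[of "r n - a" "(1/4)^n" "cmod (cinner x (e n))" "norm x"]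
      by (simp add: norm_power)
    also have "(1/4 :: real)^n = (1/2)^n * (1/2)^n" by (simp flip: power_mult_distrib)
    finally have "(1/2)^n * 1 \<le> (1/2)^n * ((1/2)^n * norm x)" by (simp only: mult.assoc mult_1_right)
    then have "1 \<le> (1/2)^n * norm x" by (rule mult_left_le_imp_le) simp
    then show ?thesis by (simp add: power_divide field_simps)
  qed
  moreover obtain n where "norm x < 2^n" using real_arch_pow[of 2 "norm x"] by auto
  ultimately show False using not_less by blast
qed

section \<open>Spectrum and essential spectrum of the modulus relative to \<open>a\<close>\<close>

context
  fixes a :: real
  assumes fin_below: "cfinite_dim (spec {..<a})"
    and fin_above: "\<And>t. a < t \<Longrightarrow> cfinite_dim (spec {t..})"
begin

lemma cfinite_dim_eig:
  assumes "r \<noteq> a"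
  shows "cfinite_dim (eig r)"
proof (cases "r < a")
  case True
  then show ?thesis by (intro cfinite_dim_subset[OF fin_below E_subset_spec]) simp
next
  case False
  then show ?thesis using assms by (intro cfinite_dim_subset[OF fin_above E_subset_spec]) auto
qed

text \<open>Eigenvalues near \<open>c\<close> stay away from \<open>a\<close>, and there only
  finitely many exist; so those different from \<open>c\<close> keep a positive distance from
  it.\<close>

lemma spectral_gap:
  assumes "c \<noteq> complex_of_real a"
  shows "\<exists>d>0. \<forall>r. eig r \<noteq> {0} \<longrightarrow> complex_of_real r - c \<noteq> 0 \<longrightarrow> d \<le> cmod (complex_of_real r - c)"
proof -
  \<comment> \<open>Half the distance from \<open>c\<close> to \<open>a\<close>: by the triangle
    inequality an eigenvalue this close to \<open>c\<close> is at least as far from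
    \<open>a\<close>.\<close>
  define \<epsilon> where "\<epsilon> = cmod (complex_of_real a - c) / 2"
  have \<epsilon>: "0 < \<epsilon>" using assms by (simp add: \<epsilon>_def)
  define Z where "Z = {r. eig r \<noteq> {0} \<and> cmod (complex_of_real r - c) < \<epsilon>}"
  have "Z \<subseteq> {r \<in> {..<a}. eig r \<noteq> {0}} \<union> {r \<in> {a + \<epsilon>..}. eig r \<noteq> {0}}"
  proof
    fix r assume r: "r \<in> Z"
    have "2 * \<epsilon> = cmod ((complex_of_real r - c) - complex_of_real (r - a))" by (simp add: \<epsilon>_def)
    also have "\<dots> \<le> cmod (complex_of_real r - c) + \<bar>r - a\<bar>"
      using norm_triangle_ineq4[of "complex_of_real r - c" "complex_of_real (r - a)"]
      by (simp only: norm_of_real)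
    finally have "\<epsilon> \<le> \<bar>r - a\<bar>" using r by (simp add: Z_def)
    then show "r \<in> {r \<in> {..<a}. eig r \<noteq> {0}} \<union> {r \<in> {a + \<epsilon>..}. eig r \<noteq> {0}}"
      using r \<epsilon> by (auto simp: Z_def)
  qed
  then have Z: "finite Z"
    using finite_eigenvalues[OF fin_below] finite_eigenvalues[OF fin_above[of "a + \<epsilon>"]] \<epsilon>
    by (meson finite_Un finite_subset less_add_same_cancel1)
  define d where "d = Min (insert \<epsilon> ((\<lambda>r. cmod (complex_of_real r - c)) ` {r \<in> Z. complex_of_real r - c \<noteq> 0}))"
  have fin: "finite (insert \<epsilon> ((\<lambda>r. cmod (complex_of_real r - c)) ` {r \<in> Z. complex_of_real r - c \<noteq> 0}))"
    using Z by simp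
  show ?thesis
  proof (intro exI[of _ d] conjI allI impI)
    show "0 < d" unfolding d_def using fin \<epsilon> by (subst Min_gr_iff) auto
    fix r assume r: "eig r \<noteq> {0}" "complex_of_real r - c \<noteq> 0"
    have "d \<le> \<epsilon>" unfolding d_def using fin by (intro Min_le) auto
    moreover have "d \<le> cmod (complex_of_real r - c)" if "r \<in> Z"
      unfolding d_def using fin r that by (intro Min_le) auto
    ultimately show "d \<le> cmod (complex_of_real r - c)" using r(1) by (cases "r \<in> Z") (auto simp: Z_def)
  qed
qed

text \<open>The gap gives closed range. The kernel is trivial or a single eigenspace with
  \<open>r \<noteq> a\<close>, and the conjugate symbol of the adjoint vanishes at the same
  indices.\<close>

lemma fredholm_abs_op_shift:
  assumes c: "c \<noteq> complex_of_real a"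
  shows "fredholm (op_shift (abs_op T) c)"
proof -
  let ?g = "\<lambda>r. complex_of_real r - c"
  have g: "bounded_symbol ?g" by (intro bounded_symbol_diff_const bounded_symbol_of_real)
  have g': "bounded_symbol (\<lambda>r. cnj (?g r))"
    using bounded_symbol_diff_const[OF bounded_symbol_of_real, of "cnj c"] by simp
  obtain d where "0 < d" "\<forall>r. eig r \<noteq> {0} \<longrightarrow> ?g r \<noteq> 0 \<longrightarrow> d \<le> cmod (?g r)"
    using spectral_gap[OF c] by (elim exE conjE)
  then have "closed (range (diag ?g))" by (intro closed_range_diag[OF g]) blast+
  moreover have fin: "cfinite_dim (spec {r. ?g r = 0})"
  proof (cases "\<exists>r. complex_of_real r = c")
    case True
    then obtain r where "complex_of_real r = c" by blast
    then have "{r. ?g r = 0} = {r}" "r \<noteq> a" using c by auto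
    then show ?thesis by (simp add: spec_singleton cfinite_dim_eig)
  qed (simp add: spec_empty cfinite_dim_zero)
  moreover have "{r. cnj (?g r) = 0} = {r. ?g r = 0}" by (auto simp flip: complex_cnj_diff)
  ultimately show ?thesis
    unfolding fredholm_def abs_op_T op_shift_diag[OF bounded_symbol_of_real] cadjoint_diag[OF g]
      null_space_diag[OF g] null_space_diag[OF g'] by metis
qed

text \<open>If \<open>r\<close> is no eigenvalue, the gap bounds the symbol of the shift away from
  0, and the shift is invertible.\<close>

lemma op_spectrum_abs_op_iff:
  assumes r: "r \<noteq> a"
  shows "complex_of_real r \<in> op_spectrum (abs_op T) \<longleftrightarrow> eig r \<noteq> {0}"
proof
  assume r0: "eig r \<noteq> {0}"
  then obtain x where x: "x \<in> eig r" "norm x = 1" by (rule exists_unit_eig)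
  have 0: "op_shift (abs_op T) (complex_of_real r) x = 0"
    using x(1) null_space_abs_op_shift_of_real[of r] by (auto simp: null_space_def)
  have False if B: "bounded_clinear B" "B \<circ> op_shift (abs_op T) (complex_of_real r) = id" for B
  proof -
    have "x = B 0" using fun_cong[OF B(2), of x] 0 by simp
    moreover have "B 0 = 0" using B(1) by (simp add: bounded_clinear_def linear_simps(3))
    ultimately show False using x(2) by simp
  qed
  then show "complex_of_real r \<in> op_spectrum (abs_op T)"
    by (auto simp: op_spectrum_def invertible_op_def)
next
  assume spec: "complex_of_real r \<in> op_spectrum (abs_op T)"
  show "eig r \<noteq> {0}"
  proof
    assume r0: "eig r = {0}"
    have "complex_of_real r \<noteq> complex_of_real a" using r by simp
    from spectral_gap[OF this] obtain d where d: "0 < d" "\<forall>s. eig s \<noteq> {0} \<longrightarrow>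
        complex_of_real s - complex_of_real r \<noteq> 0 \<longrightarrow> d \<le> cmod (complex_of_real s - complex_of_real r)"
      by (elim exE conjE)
    have "invertible_op (diag (\<lambda>s. complex_of_real s - complex_of_real r))"
    proof (rule invertible_diag[OF bounded_symbol_diff_const[OF bounded_symbol_of_real] d(1)])
      fix s assume s: "eig s \<noteq> {0}"
      then have "complex_of_real s - complex_of_real r \<noteq> 0" using r0 by auto
      with s d(2) show "d \<le> cmod (complex_of_real s - complex_of_real r)" by simp
    qed
    then show False
      using spec by (simp add: op_spectrum_def abs_op_T op_shift_diag[OF bounded_symbol_of_real])
  qed
qed

text \<open>If \<open>eig a\<close> is finite dimensional, the infinite dimension must sit above
  \<open>a\<close>. Each \<open>spec {t..}\<close> with \<open>a < t\<close> is finite dimensional,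
  so eigenvalues accumulate at \<open>a\<close> from above and the range is not closed.\<close>

lemma not_fredholm_abs_op_shift:
  assumes inf: "\<not> cfinite_dim (UNIV :: 'a set)"
  shows "\<not> fredholm (op_shift (abs_op T) (complex_of_real a))"
proof
  assume "fredholm (op_shift (abs_op T) (complex_of_real a))"
  then have cl: "closed (range (diag (\<lambda>r. complex_of_real r - complex_of_real a)))"
    and fin: "cfinite_dim (eig a)"
    by (auto simp: fredholm_def null_space_abs_op_shift_of_real)
       (simp add: abs_op_T op_shift_diag[OF bounded_symbol_of_real])
  have fin': "cfinite_dim (spec ({..<a} \<union> {a}))"
    using fin_below fin by (intro cfinite_dim_spec_Un) (auto simp: spec_singleton)
  have inf': "\<not> cfinite_dim (spec {a<..})"
    using inf
  proof (rule contrapos_nn)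
    assume "cfinite_dim (spec {a<..})"
    from cfinite_dim_spec_Un[OF fin' this]
    have "cfinite_dim (spec ({..<a} \<union> {a} \<union> {a<..}))" by fastforce
    moreover have "{..<a} \<union> {a} \<union> {a<..} = UNIV" by auto
    ultimately show "cfinite_dim (UNIV :: 'a set)" by (simp only: spec_UNIV)
  qed
  have "\<exists>r. a < r \<and> r < a + e \<and> eig r \<noteq> {0}" if "0 < e" for e
  proof (rule ccontr)
    assume none: "\<nexists>r. a < r \<and> r < a + e \<and> eig r \<noteq> {0}"
    have "spec {a<..} = spec {a + e..}"
    proof (rule spec_cong)
      show "r \<in> {a<..} \<longleftrightarrow> r \<in> {a + e..}" if "eig r \<noteq> {0}" for r
        using none that \<open>0 < e\<close> by (cases "r < a + e") auto
    qed
    then show False using inf' fin_above[of "a + e"] that by simp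
  qed
  from accumulating_eigenvalues_not_closed_range[OF this] cl show False by blast
qed

lemma ess_spectrum_abs_op:
  assumes "\<not> cfinite_dim (UNIV :: 'a set)"
  shows "ess_spectrum (abs_op T) = {complex_of_real a}"
  using fredholm_abs_op_shift not_fredholm_abs_op_shift[OF assms] unfolding ess_spectrum_def by blast

lemma countable_eigenvalues_above: "countable {r. a < r \<and> eig r \<noteq> {0}}"
proof -
  have "{r. a < r \<and> eig r \<noteq> {0}} \<subseteq> (\<Union>n. {r \<in> {a + inverse (real (Suc n))..}. eig r \<noteq> {0}})"
  proof
    fix r assume r: "r \<in> {r. a < r \<and> eig r \<noteq> {0}}"
    then have "0 < r - a" by simp
    from reals_Archimedean[OF this] obtain n where "inverse (real (Suc n)) < r - a" ..
    then show "r \<in> (\<Union>n. {r \<in> {a + inverse (real (Suc n))..}. eig r \<noteq> {0}})"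
      using r by (intro UN_I[of n]) simp_all
  qed
  moreover have "finite {r \<in> {a + inverse (real (Suc n))..}. eig r \<noteq> {0}}" for n
    by (intro finite_eigenvalues fin_above) simp
  then have "countable (\<Union>n. {r \<in> {a + inverse (real (Suc n))..}. eig r \<noteq> {0}})"
    by (intro countable_UN[OF countableI_type] countable_finite)
  ultimately show ?thesis by (rule countable_subset)
qed

lemma finite_eigenvalues_below: "finite {r. r < a \<and> eig r \<noteq> {0}}"
  using finite_eigenvalues[OF fin_below] by simp

end

end

section \<open>The decomposition\<close>

text \<open>The image of a basis of \<open>M\<close> is independent with equally many elements,
  hence spans \<open>M\<close>. This makes isometries on finite-dimensional eigenspaces
  onto.\<close>

lemma finite_dim_injective_imp_surjective:
  fixes T :: "'a::chilbert_space \<Rightarrow> 'a"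
  assumes T: "bounded_clinear T" and M: "csubspace M" "cfinite_dim M"
    and into: "\<And>x. x \<in> M \<Longrightarrow> T x \<in> M"
    and inj: "\<And>x. x \<in> M \<Longrightarrow> T x = 0 \<Longrightarrow> x = 0"
  shows "M \<subseteq> T ` M"
proof
  fix y assume y: "y \<in> M"
  interpret T: bounded_linear T using T by (simp add: bounded_clinear_def)
  have lin: "Vector_Spaces.linear scaleC scaleC T"
    using T complex_vector.vector_space_axioms
    by (simp add: Vector_Spaces.linear_iff T.add bounded_clinear_def)
  interpret TC: Vector_Spaces.linear "scaleC :: complex \<Rightarrow> 'a \<Rightarrow> 'a" "scaleC :: complex \<Rightarrow> 'a \<Rightarrow> 'a" T by (rule lin)
  obtain B where B: "B \<subseteq> M" "complex_vector.independent B" "M \<subseteq> cspan B"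
    by (rule complex_vector.maximal_independent_subset)
  obtain C where C: "finite C" "M \<subseteq> cspan C" using M(2) by (auto simp: cfinite_dim_def)
  have finB: "finite B"
    using complex_vector.independent_span_bound[OF C(1) B(2)] B(1) C(2) by blast
  have span_B: "cspan B \<subseteq> M" by (rule complex_vector.span_minimal[OF B(1) M(1)])
  have inj_M: "inj_on T M"
  proof (rule inj_onI)
    fix u v assume uv: "u \<in> M" "v \<in> M" "T u = T v"
    then have "T (u - v) = 0" by (simp add: T.diff)
    moreover have "u - v \<in> M" using M(1) uv by (intro complex_vector.subspace_diff)
    ultimately show "u = v" using inj[of "u - v"] by simp
  qed
  have "complex_vector.independent (T ` B)"
    by (rule TC.independent_injective_image[folded cspan_def, OF B(2) inj_on_subset[OF inj_M span_B]])
  have "y \<in> cspan (T ` B)"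
  proof (rule ccontr)
    assume *: "y \<notin> cspan (T ` B)"
    then have "complex_vector.independent (insert y (T ` B))"
      by (rule complex_vector.independent_insertI) fact
    moreover have "insert y (T ` B) \<subseteq> cspan B" using y into B(1,3) by blast
    ultimately have "card (insert y (T ` B)) \<le> card B"
      using complex_vector.independent_span_bound[OF finB] by blast
    moreover have "y \<notin> T ` B" using * complex_vector.span_base[of y "T ` B"] by auto
    moreover have "card (T ` B) = card B" by (rule card_image[OF inj_on_subset[OF inj_M B(1)]])
    ultimately show False using finB by simp
  qed
  then have "y \<in> T ` cspan B" by (simp add: TC.span_image[folded cspan_def])
  then show "y \<in> T ` M" using span_B by blast
qed

lemma is_hilbert_sum_reindex:
  assumes sum: "is_hilbert_sum J M S" and h: "bij_betw h I J" and M': "\<And>i. i \<in> I \<Longrightarrow> M' i = M (h i)"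
  shows "is_hilbert_sum I M' S"
proof -
  have hJ: "h i \<in> J" if "i \<in> I" for i using h that by (auto simp: bij_betw_def)
  have ne: "h i \<noteq> h j" if "i \<in> I" "j \<in> I" "i \<noteq> j" for i j
    using h that by (auto simp: bij_betw_def inj_on_def)
  have "(\<exists>f. (\<forall>j\<in>J. f j \<in> M j) \<and> (f has_sum x) J) \<longleftrightarrow>
      (\<exists>f. (\<forall>i\<in>I. f i \<in> M' i) \<and> (f has_sum x) I)" for x
  proof
    assume "\<exists>f. (\<forall>j\<in>J. f j \<in> M j) \<and> (f has_sum x) J"
    then obtain f where f: "\<forall>j\<in>J. f j \<in> M j" "(f has_sum x) J" by blast
    then have "((\<lambda>i. f (h i)) has_sum x) I" using has_sum_reindex_bij_betw[OF h] by blast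
    moreover have "\<forall>i\<in>I. f (h i) \<in> M' i" using f(1) hJ M' by simp
    ultimately show "\<exists>f. (\<forall>i\<in>I. f i \<in> M' i) \<and> (f has_sum x) I"
      by (intro exI[of _ "\<lambda>i. f (h i)"]) blast
  next
    assume "\<exists>f. (\<forall>i\<in>I. f i \<in> M' i) \<and> (f has_sum x) I"
    then obtain f where f: "\<forall>i\<in>I. f i \<in> M' i" "(f has_sum x) I" by blast
    let ?k = "inv_into I h"
    have k: "bij_betw ?k J I" by (rule bij_betw_inv_into[OF h])
    have "((\<lambda>j. f (?k j)) has_sum x) J" using f(2) has_sum_reindex_bij_betw[OF k] by blast
    moreover have "f (?k j) \<in> M j" if "j \<in> J" for j
    proof -
      have "?k j \<in> I" using k that by (auto simp: bij_betw_def)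
      moreover have "h (?k j) = j" by (rule bij_betw_inv_into_right[OF h that])
      ultimately show ?thesis using f(1) M'[of "?k j"] by auto
    qed
    ultimately show "\<exists>f. (\<forall>j\<in>J. f j \<in> M j) \<and> (f has_sum x) J"
      by (intro exI[of _ "\<lambda>j. f (?k j)"]) blast
  qed
  then show ?thesis
    using sum hJ ne M' unfolding is_hilbert_sum_def by simp
qed

lemma countable_enumeration:
  assumes "countable R"
  obtains n :: enat and h :: "nat \<Rightarrow> 'b" where "bij_betw h {i. 1 \<le> i \<and> enat i \<le> n} R"
proof (cases "finite R")
  case True
  then obtain h where "bij_betw h {1..card R} R" using ex_bij_betw_nat_finite_1 by blast
  moreover have "{i. 1 \<le> i \<and> enat i \<le> enat (card R)} = {1..card R}" by auto
  ultimately show ?thesis using that[of h "enat (card R)"] by simp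
next
  case False
  \<comment> \<open>\<open>from_nat_into\<close> counts from 0, the required enumeration from
    1.\<close>
  have "bij_betw (\<lambda>i :: nat. i - 1) {1..} UNIV"
    by (rule bij_betwI[of _ _ _ Suc]) auto
  from bij_betw_trans[OF this bij_betw_from_nat_into[OF assms False]]
  have "bij_betw (from_nat_into R \<circ> (\<lambda>i. i - 1)) {i. 1 \<le> i \<and> enat i \<le> \<infinity>} R"
    by (simp add: atLeast_def)
  then show ?thesis by (rule that)
qed

context an_quasinormal
begin

text \<open>Invariance of the eigenspaces under one of \<open>T\<close> and \<open>S\<close> gives
  invariance of \<open>spec R\<close> under the other; invariance under \<open>S\<close> is what
  carries over to the complement for \<open>T\<close>.\<close>

lemma reducing_spec: "reducing T (spec R)"
proof -
  have T_spec: "T x \<in> spec R" if "x \<in> spec R" for x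
    using that S_eig unfolding spec_def ccomplement_def by (fastforce simp: cinner_T_left)
  have S_spec: "S x \<in> spec R" if "x \<in> spec R" for x
    using that T_eig unfolding spec_def ccomplement_def by (fastforce simp: cinner_S_left)
  then have "T x \<in> ccomplement (spec R)" if "x \<in> ccomplement (spec R)" for x
    using that by (auto simp: ccomplement_def cinner_T_left)
  with T_spec show ?thesis
    unfolding reducing_def using closed_csubspace_spec by blast
qed

text \<open>For \<open>r = 0\<close> the operator \<open>T\<close> vanishes on \<^term>\<open>eig r\<close>, and any isometry will do.\<close>

definition polar :: "real \<Rightarrow> 'a \<Rightarrow> 'a" where
  "polar r x = (if r = 0 then x else inverse r *\<^sub>R T x)"

lemma scaleR_polar: "x \<in> eig r \<Longrightarrow> r *\<^sub>R polar r x = T x"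
  using norm_T_eig[of x r] by (auto simp: polar_def)

lemma isometry_on_polar: "isometry_on (eig r) (polar r)"
proof (cases "r < 0")
  case True
  then show ?thesis
    by (auto simp: eig_def isometry_on_def bounded_clinear_on_def polar_def T.zero intro!: exI[of _ 0])
next
  case False
  have norm: "norm (polar r x) = norm x" if "x \<in> eig r" for x
    using False norm_T_eig[OF that] by (simp add: polar_def)
  have "bounded_clinear_on (eig r) (polar r)"
    unfolding bounded_clinear_on_def
  proof (intro conjI ballI allI exI[of _ 1])
    show "polar r x \<in> eig r" if "x \<in> eig r" for x
      using that by (auto simp: polar_def intro: closed_csubspaceD(5)[OF closed_csubspace_eig] T_eig)
    show "polar r (x + y) = polar r x + polar r y" for x y
      by (simp add: polar_def T.add scaleR_add_right)
    show "polar r (c *\<^sub>C x) = c *\<^sub>C polar r x" for c x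
      by (simp add: polar_def T_scaleC scaleR_scaleC scaleC_scaleC mult.commute)
  qed (simp add: norm)
  then show ?thesis using norm by (simp add: isometry_on_def)
qed

text \<open>For \<open>0 < r\<close> the adjoint is \<open>S\<close> scaled by
  \<open>inverse r\<close>. The eigenvalue equation makes it a left inverse, and surjectivity from
  finite dimension makes it a right inverse.\<close>

lemma unitary_on_polar:
  assumes fin: "cfinite_dim (eig r)"
  shows "unitary_on (eig r) (polar r)"
proof -
  have blin: "bounded_clinear_on (eig r) (polar r)"
    using isometry_on_polar by (simp add: isometry_on_def)
  show ?thesis
  proof (cases "0 < r")
    case False
    \<comment> \<open>For \<open>r = 0\<close> by the first clause of \<open>polar\<close>; for
      \<open>r < 0\<close> because \<open>eig r\<close> is trivial.\<close>
    then have "polar r x = x" if "x \<in> eig r" for x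
      using that by (auto simp: polar_def eig_def T.zero split: if_splits)
    then show ?thesis
      using blin unfolding unitary_on_def is_cadjoint_on_def
      by (intro conjI exI[of _ "polar r"]) simp_all
  next
    case True
    define W where "W x = inverse r *\<^sub>R S x" for x
    have W: "W x \<in> eig r" if "x \<in> eig r" for x
      unfolding W_def by (intro closed_csubspaceD(5)[OF closed_csubspace_eig] S_eig that)
    have WU: "W (polar r x) = x" if "x \<in> eig r" for x
      using that True by (simp add: W_def polar_def S.scaleR eig_def power2_eq_square field_simps)
    have UW: "polar r (W y) = y" if "y \<in> eig r" for y
    proof -
      have "eig r \<subseteq> T ` eig r"
      proof (rule finite_dim_injective_imp_surjective[OF bounded_clinear_T _ fin T_eig])
        show "csubspace (eig r)" using closed_csubspace_eig by (simp add: closed_csubspace_def)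
        show "x = 0" if "x \<in> eig r" "T x = 0" for x using norm_T_eig[OF that(1)] that(2) True by simp
      qed
      moreover have "r *\<^sub>R y \<in> eig r" by (rule closed_csubspaceD(5)[OF closed_csubspace_eig that])
      ultimately obtain x where x: "x \<in> eig r" "r *\<^sub>R y = T x" by blast
      have "inverse r *\<^sub>R (r *\<^sub>R y) = polar r x" using True x(2) by (simp add: polar_def)
      then have "y = polar r x" using True by simp
      then show ?thesis using WU[OF x(1)] by simp
    qed
    obtain K where K: "\<And>x. norm (S x) \<le> norm x * K" using S.bounded by blast
    have "bounded_clinear_on (eig r) W"
      unfolding bounded_clinear_on_def
    proof (intro conjI ballI allI exI[of _ "inverse r * K"])
      show "W (x + y) = W x + W y" for x y by (simp add: W_def S.add scaleR_add_right)
      show "W (c *\<^sub>C x) = c *\<^sub>C W x" for c x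
        by (simp add: W_def S_scaleC scaleR_scaleC scaleC_scaleC mult.commute)
      show "norm (W x) \<le> norm x * (inverse r * K)" for x
        using mult_left_mono[OF K[of x], of "inverse r"] True by (simp add: W_def mult_ac)
    qed (rule W)
    moreover have "cinner (polar r x) y = cinner x (W y)" for x y
      using True by (simp add: polar_def W_def cinner_scaleR_left cinner_scaleR_right cinner_T_left)
    ultimately show ?thesis
      unfolding unitary_on_def is_cadjoint_on_def using blin WU UW by blast
  qed
qed

lemma is_op_hilbert_sum_polar:
  assumes "\<And>i. i \<in> I \<Longrightarrow> M i = eig (h i)"
  shows "is_op_hilbert_sum I M (\<lambda>i x. h i *\<^sub>R polar (h i) x) T"
  unfolding is_op_hilbert_sum_def
proof (intro allI impI, elim conjE)
  fix f x assume f: "\<forall>i\<in>I. f i \<in> M i" "(f has_sum x) I"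
  have "h i *\<^sub>R polar (h i) (f i) = T (f i)" if "i \<in> I" for i
    using bspec[OF f(1) that] assms[OF that] by (intro scaleR_polar) simp
  then show "((\<lambda>i. h i *\<^sub>R polar (h i) (f i)) has_sum T x) I"
    using has_sum_bounded_linear[OF T.bounded_linear_axioms f(2)] by (simp cong: has_sum_cong)
qed

lemma eig_le_onorm:
  assumes "eig r \<noteq> {0}"
  shows "r \<le> onorm T"
proof -
  obtain x where x: "x \<in> eig r" "norm x = 1" using exists_unit_eig[OF assms] .
  then show ?thesis
    using onorm[OF T.bounded_linear_axioms, of x] norm_T_eig[OF x(1)] by simp
qed

lemma min_modulus_le_eig:
  assumes "eig r \<noteq> {0}"
  shows "min_modulus T \<le> r"
proof -
  obtain x where x: "x \<in> eig r" "norm x = 1" using exists_unit_eig[OF assms] .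
  then have "min_modulus T \<le> norm (T x)"
    unfolding min_modulus_def by (intro cINF_lower bdd_belowI2[of _ 0]) auto
  then show ?thesis using norm_T_eig[OF x(1)] x(2) by simp
qed

end

theorem theorem3p2:
  fixes T :: "'a::chilbert_space \<Rightarrow> 'a"
  assumes infinite_dim: "\<not> cfinite_dim (UNIV :: 'a set)"
    and AN: "absolutely_norm_attaining T"
    and quasinormal: "quasinormal T"
  shows "\<exists>(H\<^sub>1 :: 'a set) (H_inf :: 'a set) (H\<^sub>2 :: 'a set) (n :: enat) (m :: nat)
      (\<alpha> :: real) (\<alpha>s :: nat \<Rightarrow> real) (\<beta>s :: nat \<Rightarrow> real)
      (U :: nat \<Rightarrow> 'a \<Rightarrow> 'a) (V_inf :: 'a \<Rightarrow> 'a) (V :: nat \<Rightarrow> 'a \<Rightarrow> 'a)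
      (T\<^sub>1 :: 'a \<Rightarrow> 'a) (T\<^sub>2 :: 'a \<Rightarrow> 'a).
    let I = {i. 1 \<le> i \<and> enat i \<le> n};
        J = {1..m};
        N = (\<lambda>r :: real. null_space (op_shift (abs_op T) (complex_of_real r)))
    in
      reducing T H\<^sub>1 \<and> reducing T H_inf \<and> reducing T H\<^sub>2 \<and>
      cfinite_dim H\<^sub>2 \<and>
      is_orthogonal_sum3 H\<^sub>1 H_inf H\<^sub>2 UNIV \<and>
      \<comment> \<open>the form of \<open>T\<close> with respect to this decomposition\<close>
      is_op_hilbert_sum I (\<lambda>i. N (\<alpha>s i)) (\<lambda>i x. \<alpha>s i *\<^sub>R U i x) T\<^sub>1 \<and>
      is_op_hilbert_sum J (\<lambda>j. N (\<beta>s j)) (\<lambda>j x. \<beta>s j *\<^sub>R V j x) T\<^sub>2 \<and>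
      (\<forall>x\<in>H\<^sub>1. \<forall>y\<in>H_inf. \<forall>z\<in>H\<^sub>2. T (x + y + z) = T\<^sub>1 x + \<alpha> *\<^sub>R V_inf y + T\<^sub>2 z) \<and>
      \<comment> \<open>(i)\<close>
      ess_spectrum (abs_op T) = {complex_of_real \<alpha>} \<and> 0 \<le> \<alpha> \<and>
      H_inf = N \<alpha> \<and> isometry_on H_inf V_inf \<and>
      \<comment> \<open>(ii)\<close>
      inj_on \<alpha>s I \<and>
      complex_of_real ` \<alpha>s ` I
        = complex_of_real ` {\<alpha><..onorm T} \<inter> op_spectrum (abs_op T) \<and>
      is_hilbert_sum I (\<lambda>i. N (\<alpha>s i)) H\<^sub>1 \<and>
      (\<forall>i\<in>I. unitary_on (N (\<alpha>s i)) (U i)) \<and>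
      \<comment> \<open>(iii)\<close>
      inj_on \<beta>s J \<and>
      complex_of_real ` \<beta>s ` J
        = complex_of_real ` {min_modulus T..<\<alpha>} \<inter> op_spectrum (abs_op T) \<and>
      is_hilbert_sum J (\<lambda>j. N (\<beta>s j)) H\<^sub>2 \<and>
      (\<forall>j\<in>J. unitary_on (N (\<beta>s j)) (V j))"
proof -
  define S where "S = cadjoint T"
  have T: "bounded_clinear T" using AN by (simp add: absolutely_norm_attaining_def)
  obtain S' where S': "is_cadjoint_on UNIV T S'" by (rule bounded_clinear_cadjoint_exists[OF T])
  then have adj: "is_cadjoint_on UNIV T S" using cadjoint_eqI[OF S'] by (simp add: S_def)
  interpret an_quasinormal T S
  proof
    show "T (S (T x)) = S (T (T x))" for x
      using fun_cong[OF conjunct2[OF quasinormal[unfolded quasinormal_def]], of x] by (simp add: S_def)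
  qed (fact AN adj)+
  obtain a where a: "0 \<le> a" and below: "cfinite_dim (spec {..<a})"
    and above: "\<And>t. a < t \<Longrightarrow> cfinite_dim (spec {t..})"
    by (rule essential_point_exists[OF infinite_dim]) blast
  note spectrum_iff = op_spectrum_abs_op_iff[OF below above]
  define R\<^sub>1 where "R\<^sub>1 = {r. a < r \<and> eig r \<noteq> {0}}"
  define R\<^sub>2 where "R\<^sub>2 = {r. r < a \<and> eig r \<noteq> {0}}"
  have "countable R\<^sub>1" unfolding R\<^sub>1_def by (rule countable_eigenvalues_above[OF below above])
  then obtain n :: enat and \<alpha>s where \<alpha>s: "bij_betw \<alpha>s {i. 1 \<le> i \<and> enat i \<le> n} R\<^sub>1"
    by (rule countable_enumeration)
  have "finite R\<^sub>2" unfolding R\<^sub>2_def by (rule finite_eigenvalues_below[OF below above])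
  from ex_bij_betw_nat_finite_1[OF this] obtain \<beta>s where \<beta>s: "bij_betw \<beta>s {1..card R\<^sub>2} R\<^sub>2" ..
  let ?I = "{i. 1 \<le> i \<and> enat i \<le> n}" and ?J = "{1..card R\<^sub>2}"
  let ?N = "\<lambda>r :: real. null_space (op_shift (abs_op T) (complex_of_real r))"
  have N: "?N r = eig r" for r by (rule null_space_abs_op_shift_of_real)
  have \<alpha>s_in: "\<alpha>s i \<in> R\<^sub>1" if "i \<in> ?I" for i using \<alpha>s that by (auto simp: bij_betw_def)
  have \<beta>s_in: "\<beta>s j \<in> R\<^sub>2" if "j \<in> ?J" for j using \<beta>s that by (auto simp: bij_betw_def)
  have spectrum_above: "complex_of_real ` R\<^sub>1 = complex_of_real ` {a<..onorm T} \<inter> op_spectrum (abs_op T)"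
  proof -
    \<comment> \<open>Above \<open>a\<close> the spectrum consists of eigenvalues, none of which
      exceeds \<open>onorm T\<close>.\<close>
    have "r \<in> R\<^sub>1 \<longleftrightarrow> r \<in> {a<..onorm T} \<and> complex_of_real r \<in> op_spectrum (abs_op T)" for r
      using spectrum_iff[of r] eig_le_onorm[of r] by (cases "a < r") (simp_all add: R\<^sub>1_def, metis)
    then show ?thesis by blast
  qed
  have spectrum_below: "complex_of_real ` R\<^sub>2 = complex_of_real ` {min_modulus T..<a} \<inter> op_spectrum (abs_op T)"
  proof -
    have "r \<in> R\<^sub>2 \<longleftrightarrow> r \<in> {min_modulus T..<a} \<and> complex_of_real r \<in> op_spectrum (abs_op T)" for r
      using spectrum_iff[of r] min_modulus_le_eig[of r] by (cases "r < a") (simp_all add: R\<^sub>2_def, metis)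
    then show ?thesis by blast
  qed
  have sum: "is_orthogonal_sum3 (spec {a<..}) (spec {a}) (spec {..<a}) UNIV"
  proof -
    have "\<exists>u v w. x = u + v + w \<and> u \<in> spec {a<..} \<and> v \<in> spec {a} \<and> w \<in> spec {..<a}" for x
    proof -
      have "x \<in> spec (({a<..} \<union> {a}) \<union> {..<a})"
        by (rule subsetD[OF spec_mono, of UNIV]) (auto simp: spec_UNIV)
      then obtain y w where y: "y \<in> spec ({a<..} \<union> {a})" "w \<in> spec {..<a}" "x = y + w"
        by (rule spec_split) auto
      from y(1) obtain u v where "u \<in> spec {a<..}" "v \<in> spec {a}" "y = u + v"
        by (rule spec_split) auto
      with y show ?thesis by blast
    qed
    then show ?thesis
      unfolding is_orthogonal_sum3_def
      by (intro conjI closed_csubspace_spec corthogonal_spec) auto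
  qed
  \<comment> \<open>\<open>T\<close> itself serves as both \<open>T\<^sub>1\<close> and
    \<open>T\<^sub>2\<close>: the direct sum condition concerns only convergent sums of vectors from
    the eigenspaces, where \<open>T\<close> acts as \<open>r\<close> times
    \<open>polar r\<close>.\<close>
  show ?thesis
    unfolding Let_def
  proof (rule exI[of _ "spec {a<..}"],
      rule exI[of _ "eig a"],
      rule exI[of _ "spec {..<a}"],
      rule exI[of _ "n"],
      rule exI[of _ "card R\<^sub>2"],
      rule exI[of _ "a"],
      rule exI[of _ "\<alpha>s"],
      rule exI[of _ "\<beta>s"],
      rule exI[of _ "\<lambda>i. polar (\<alpha>s i)"],
      rule exI[of _ "polar a"],
      rule exI[of _ "\<lambda>j. polar (\<beta>s j)"],
      rule exI[of _ "T"],
      rule exI[of _ "T"],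
      intro conjI ballI)
    show "reducing T (spec {a<..})" "reducing T (eig a)" "reducing T (spec {..<a})"
      using reducing_spec[of "{a}"] by (simp_all add: reducing_spec spec_singleton)
    show "is_orthogonal_sum3 (spec {a<..}) (eig a) (spec {..<a}) UNIV"
      using sum by (simp only: spec_singleton)
    show "is_op_hilbert_sum ?I (\<lambda>i. ?N (\<alpha>s i)) (\<lambda>i x. \<alpha>s i *\<^sub>R polar (\<alpha>s i) x) T"
      "is_op_hilbert_sum ?J (\<lambda>j. ?N (\<beta>s j)) (\<lambda>j x. \<beta>s j *\<^sub>R polar (\<beta>s j) x) T"
      by (rule is_op_hilbert_sum_polar, rule N)+
    show "T (x + y + z) = T x + a *\<^sub>R polar a y + T z" if "y \<in> eig a" for x y z
      using scaleR_polar[OF that] by (simp add: T.add)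
    show "ess_spectrum (abs_op T) = {complex_of_real a}"
      by (rule ess_spectrum_abs_op[OF below above infinite_dim])
    show "inj_on \<alpha>s ?I" "inj_on \<beta>s ?J" using \<alpha>s \<beta>s by (auto simp: bij_betw_def)
    show "complex_of_real ` \<alpha>s ` ?I = complex_of_real ` {a<..onorm T} \<inter> op_spectrum (abs_op T)"
      using spectrum_above \<alpha>s by (simp only: bij_betw_imp_surj_on)
    show "complex_of_real ` \<beta>s ` ?J = complex_of_real ` {min_modulus T..<a} \<inter> op_spectrum (abs_op T)"
      using spectrum_below \<beta>s by (simp only: bij_betw_imp_surj_on)
    show "is_hilbert_sum ?I (\<lambda>i. ?N (\<alpha>s i)) (spec {a<..})"
      by (rule is_hilbert_sum_reindex[OF is_hilbert_sum_spec \<alpha>s N]) (auto simp: R\<^sub>1_def)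
    show "is_hilbert_sum ?J (\<lambda>j. ?N (\<beta>s j)) (spec {..<a})"
      by (rule is_hilbert_sum_reindex[OF is_hilbert_sum_spec \<beta>s N]) (auto simp: R\<^sub>2_def)
    show "unitary_on (?N (\<alpha>s i)) (polar (\<alpha>s i))" if "i \<in> ?I" for i
    proof -
      have "\<alpha>s i \<noteq> a" using \<alpha>s_in[OF that] by (simp add: R\<^sub>1_def)
      from unitary_on_polar[OF cfinite_dim_eig[OF below above this]] show ?thesis by (simp only: N)
    qed
    show "unitary_on (?N (\<beta>s j)) (polar (\<beta>s j))" if "j \<in> ?J" for j
    proof -
      have "\<beta>s j \<noteq> a" using \<beta>s_in[OF that] by (simp add: R\<^sub>2_def)
      from unitary_on_polar[OF cfinite_dim_eig[OF below above this]] show ?thesis by (simp only: N)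
    qed
  qed (fact below a isometry_on_polar N[symmetric])+
qed

end
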